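(* Let $G$ be a group, let $\mathscr{C}$ and $\mathscr{D}$ be $G$-categories, and let $\Theta:\mathscr{C}\to\mathscr{D}$ be a $G$-equivariant functor which is an equivalence of categories (nonequivariantly, i.e. after forgetting the $G$-actions). Then for every subgroup $H\subseteq G$, postcomposition with $\Theta$ induces an equivalence of categories on homotopy fixed points $\mathscr{C}^{hH}\to\mathscr{D}^{hH}$.
   Context: A $G$-category is a category $\mathscr{C}$ with endofunctors $(g\cdot)$, $g\in G$, such that $(e\cdot)=\mathrm{id}$ and $(g\cdot)\circ(h\cdot)=(gh)\cdot$; a $G$-equivariant functor strictly commutes with these. For $H\subseteq G$, the fixed category $\mathscr{C}^H$ is the subcategory of objects and morphisms fixed by all $h\in H$. $\widetilde G$ is the category with object set $G$ and exactly one morphism between any two objects, with $G$ acting by left translation on objects and diagonally on morphisms. $\mathrm{Cat}(\widetilde G,\mathscr{C})$ is the $G$-category of all functors $\widetilde G\to\mathscr{C}$ and all natural transformations, with conjugation action $(gF)(x)=gF(g^{-1}x)$, $(g\eta)_x=g\,\eta_{g^{-1}x}$. The homotopy fixed point category is $\mathscr{C}^{hH}=\mathrm{Cat}(\widetilde G,\mathscr{C})^H$ (equivalent to $\mathrm{Cat}(\widetilde H,\mathscr{C})^H$). *)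

theory Defs
  imports "HOL-Algebra.Group" "HOL-Library.FuncSet"
begin

section \<open>Categories, functors, natural transformations\<close>

text \<open>Small categories, with arbitrary carrier sets of objects and arrows;
  \<open>comp C g f\<close> is the composite of \<open>g\<close> after \<open>f\<close>.\<close>

record ('o, 'a) cat =
  ob :: "'o set"
  arr :: "'a set"
  src :: "'a \<Rightarrow> 'o"
  tgt :: "'a \<Rightarrow> 'o"
  ident :: "'o \<Rightarrow> 'a"
  comp :: "'a \<Rightarrow> 'a \<Rightarrow> 'a"

locale category =
  fixes C :: "('o, 'a, 'z) cat_scheme"
  assumes src_in: "f \<in> arr C \<Longrightarrow> src C f \<in> ob C"
    and tgt_in: "f \<in> arr C \<Longrightarrow> tgt C f \<in> ob C"
    and ident_in: "x \<in> ob C \<Longrightarrow> ident C x \<in> arr C"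
    and src_ident: "x \<in> ob C \<Longrightarrow> src C (ident C x) = x"
    and tgt_ident: "x \<in> ob C \<Longrightarrow> tgt C (ident C x) = x"
    and comp_in: "\<lbrakk>f \<in> arr C; g \<in> arr C; src C g = tgt C f\<rbrakk> \<Longrightarrow> comp C g f \<in> arr C"
    and src_comp: "\<lbrakk>f \<in> arr C; g \<in> arr C; src C g = tgt C f\<rbrakk> \<Longrightarrow> src C (comp C g f) = src C f"
    and tgt_comp: "\<lbrakk>f \<in> arr C; g \<in> arr C; src C g = tgt C f\<rbrakk> \<Longrightarrow> tgt C (comp C g f) = tgt C g"
    and comp_ident_right: "f \<in> arr C \<Longrightarrow> comp C f (ident C (src C f)) = f"
    and comp_ident_left: "f \<in> arr C \<Longrightarrow> comp C (ident C (tgt C f)) f = f"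
    and comp_assoc: "\<lbrakk>f \<in> arr C; g \<in> arr C; h \<in> arr C; src C g = tgt C f; src C h = tgt C g\<rbrakk>
      \<Longrightarrow> comp C h (comp C g f) = comp C (comp C h g) f"

definition hom_set :: "('o, 'a, 'z) cat_scheme \<Rightarrow> 'o \<Rightarrow> 'o \<Rightarrow> 'a set" where
  "hom_set C x y = {f \<in> arr C. src C f = x \<and> tgt C f = y}"

definition is_iso :: "('o, 'a, 'z) cat_scheme \<Rightarrow> 'a \<Rightarrow> bool" where
  "is_iso C f \<longleftrightarrow> f \<in> arr C \<and>
    (\<exists>g \<in> hom_set C (tgt C f) (src C f).
       comp C g f = ident C (src C f) \<and> comp C f g = ident C (tgt C f))"

record ('o, 'a, 'p, 'b) fctr =
  on_ob :: "'o \<Rightarrow> 'p"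
  on_arr :: "'a \<Rightarrow> 'b"

definition is_functor ::
  "('o, 'a, 'y) cat_scheme \<Rightarrow> ('p, 'b, 'z) cat_scheme \<Rightarrow> ('o, 'a, 'p, 'b) fctr \<Rightarrow> bool" where
  "is_functor C D F \<longleftrightarrow> category C \<and> category D \<and>
    (\<forall>x \<in> ob C. on_ob F x \<in> ob D) \<and>
    (\<forall>f \<in> arr C. on_arr F f \<in> hom_set D (on_ob F (src C f)) (on_ob F (tgt C f))) \<and>
    (\<forall>x \<in> ob C. on_arr F (ident C x) = ident D (on_ob F x)) \<and>
    (\<forall>f \<in> arr C. \<forall>g \<in> arr C. src C g = tgt C f \<longrightarrow>
       on_arr F (comp C g f) = comp D (on_arr F g) (on_arr F f))"

definition id_fctr :: "('o, 'a, 'o, 'a) fctr" where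
  "id_fctr = \<lparr>on_ob = (\<lambda>x. x), on_arr = (\<lambda>f. f)\<rparr>"

definition comp_fctr ::
  "('p, 'b, 'q, 'c) fctr \<Rightarrow> ('o, 'a, 'p, 'b) fctr \<Rightarrow> ('o, 'a, 'q, 'c) fctr" where
  "comp_fctr K F = \<lparr>on_ob = (\<lambda>x. on_ob K (on_ob F x)), on_arr = (\<lambda>f. on_arr K (on_arr F f))\<rparr>"

definition is_nat_trans ::
  "('o, 'a, 'y) cat_scheme \<Rightarrow> ('p, 'b, 'z) cat_scheme \<Rightarrow>
   ('o, 'a, 'p, 'b) fctr \<Rightarrow> ('o, 'a, 'p, 'b) fctr \<Rightarrow> ('o \<Rightarrow> 'b) \<Rightarrow> bool" where
  "is_nat_trans C D F F' \<eta> \<longleftrightarrow> is_functor C D F \<and> is_functor C D F' \<and>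
    (\<forall>x \<in> ob C. \<eta> x \<in> hom_set D (on_ob F x) (on_ob F' x)) \<and>
    (\<forall>f \<in> arr C. comp D (on_arr F' f) (\<eta> (src C f)) = comp D (\<eta> (tgt C f)) (on_arr F f))"

definition is_nat_iso ::
  "('o, 'a, 'y) cat_scheme \<Rightarrow> ('p, 'b, 'z) cat_scheme \<Rightarrow>
   ('o, 'a, 'p, 'b) fctr \<Rightarrow> ('o, 'a, 'p, 'b) fctr \<Rightarrow> ('o \<Rightarrow> 'b) \<Rightarrow> bool" where
  "is_nat_iso C D F F' \<eta> \<longleftrightarrow> is_nat_trans C D F F' \<eta> \<and> (\<forall>x \<in> ob C. is_iso D (\<eta> x))"

definition is_equivalence ::
  "('o, 'a, 'y) cat_scheme \<Rightarrow> ('p, 'b, 'z) cat_scheme \<Rightarrow> ('o, 'a, 'p, 'b) fctr \<Rightarrow> bool" where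
  "is_equivalence C D F \<longleftrightarrow> is_functor C D F \<and>
    (\<exists>K. is_functor D C K \<and>
      (\<exists>\<eta>. is_nat_iso C C id_fctr (comp_fctr K F) \<eta>) \<and>
      (\<exists>\<epsilon>. is_nat_iso D D (comp_fctr F K) id_fctr \<epsilon>))"


section \<open>Categories with an action of a group\<close>

record ('g, 'o, 'a) gcat = "('o, 'a) cat" +
  act_ob :: "'g \<Rightarrow> 'o \<Rightarrow> 'o"
  act_arr :: "'g \<Rightarrow> 'a \<Rightarrow> 'a"

definition is_gcat :: "('g, 'm) monoid_scheme \<Rightarrow> ('g, 'o, 'a, 'z) gcat_scheme \<Rightarrow> bool" where
  "is_gcat G C \<longleftrightarrow> group G \<and> category C \<and>
    (\<forall>g \<in> carrier G. is_functor C C \<lparr>on_ob = act_ob C g, on_arr = act_arr C g\<rparr>) \<and>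
    (\<forall>x \<in> ob C. act_ob C \<one>\<^bsub>G\<^esub> x = x) \<and>
    (\<forall>f \<in> arr C. act_arr C \<one>\<^bsub>G\<^esub> f = f) \<and>
    (\<forall>g \<in> carrier G. \<forall>h \<in> carrier G. \<forall>x \<in> ob C.
       act_ob C g (act_ob C h x) = act_ob C (g \<otimes>\<^bsub>G\<^esub> h) x) \<and>
    (\<forall>g \<in> carrier G. \<forall>h \<in> carrier G. \<forall>f \<in> arr C.
       act_arr C g (act_arr C h f) = act_arr C (g \<otimes>\<^bsub>G\<^esub> h) f)"

definition is_equivariant_functor ::
  "('g, 'm) monoid_scheme \<Rightarrow> ('g, 'o, 'a, 'y) gcat_scheme \<Rightarrow> ('g, 'p, 'b, 'z) gcat_scheme \<Rightarrow>
   ('o, 'a, 'p, 'b) fctr \<Rightarrow> bool" where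
  "is_equivariant_functor G C D F \<longleftrightarrow> is_functor C D F \<and>
    (\<forall>g \<in> carrier G. \<forall>x \<in> ob C. on_ob F (act_ob C g x) = act_ob D g (on_ob F x)) \<and>
    (\<forall>g \<in> carrier G. \<forall>f \<in> arr C. on_arr F (act_arr C g f) = act_arr D g (on_arr F f))"

definition fixed_cat :: "'g set \<Rightarrow> ('g, 'o, 'a, 'z) gcat_scheme \<Rightarrow> ('o, 'a) cat" where
  "fixed_cat H C =
    \<lparr>ob = {x \<in> ob C. \<forall>h \<in> H. act_ob C h x = x},
     arr = {f \<in> arr C. \<forall>h \<in> H. act_arr C h f = f},
     src = src C, tgt = tgt C, ident = ident C, comp = comp C\<rparr>"

text \<open>The category \<open>G~\<close>: the pair \<open>(x, y)\<close> is the unique arrow from \<open>x\<close> to \<open>y\<close>.\<close>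

definition tilde :: "('g, 'm) monoid_scheme \<Rightarrow> ('g, 'g, 'g \<times> 'g) gcat" where
  "tilde G =
    \<lparr>ob = carrier G, arr = carrier G \<times> carrier G, src = fst, tgt = snd,
     ident = (\<lambda>x. (x, x)), comp = (\<lambda>k f. (fst f, snd k)),
     act_ob = (\<lambda>g x. g \<otimes>\<^bsub>G\<^esub> x),
     act_arr = (\<lambda>g f. (g \<otimes>\<^bsub>G\<^esub> fst f, g \<otimes>\<^bsub>G\<^esub> snd f))\<rparr>"


section \<open>Functor categories with the conjugation action\<close>

text \<open>Functors and natural transformations are normalised to be \<open>undefined\<close> outside the objects
  and arrows of the source category, so that HOL equality of objects and arrows of the functor
  category, and hence being fixed under the action, is equality on the source category only.
  An arrow of the functor category is a triple of source, target and family of components.\<close>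

definition restrict_fctr ::
  "('o, 'a, 'z) cat_scheme \<Rightarrow> ('o, 'a, 'p, 'b) fctr \<Rightarrow> ('o, 'a, 'p, 'b) fctr" where
  "restrict_fctr X F = \<lparr>on_ob = restrict (on_ob F) (ob X), on_arr = restrict (on_arr F) (arr X)\<rparr>"

definition conj_ob ::
  "('g, 'm) monoid_scheme \<Rightarrow> ('g, 'o, 'a, 'y) gcat_scheme \<Rightarrow> ('g, 'p, 'b, 'z) gcat_scheme \<Rightarrow>
   'g \<Rightarrow> ('o, 'a, 'p, 'b) fctr \<Rightarrow> ('o, 'a, 'p, 'b) fctr" where
  "conj_ob G X C g F = restrict_fctr X
    \<lparr>on_ob = (\<lambda>x. act_ob C g (on_ob F (act_ob X (inv\<^bsub>G\<^esub> g) x))),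
     on_arr = (\<lambda>f. act_arr C g (on_arr F (act_arr X (inv\<^bsub>G\<^esub> g) f)))\<rparr>"

type_synonym ('o, 'a, 'p, 'b) nat_arrow =
  "('o, 'a, 'p, 'b) fctr \<times> ('o, 'a, 'p, 'b) fctr \<times> ('o \<Rightarrow> 'b)"

definition conj_arr ::
  "('g, 'm) monoid_scheme \<Rightarrow> ('g, 'o, 'a, 'y) gcat_scheme \<Rightarrow> ('g, 'p, 'b, 'z) gcat_scheme \<Rightarrow>
   'g \<Rightarrow> ('o, 'a, 'p, 'b) nat_arrow \<Rightarrow> ('o, 'a, 'p, 'b) nat_arrow" where
  "conj_arr G X C g = (\<lambda>(F, F', \<eta>).
    (conj_ob G X C g F, conj_ob G X C g F',
     \<lambda>x \<in> ob X. act_arr C g (\<eta> (act_ob X (inv\<^bsub>G\<^esub> g) x))))"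

definition functor_gcat ::
  "('g, 'm) monoid_scheme \<Rightarrow> ('g, 'o, 'a, 'y) gcat_scheme \<Rightarrow> ('g, 'p, 'b, 'z) gcat_scheme \<Rightarrow>
   ('g, ('o, 'a, 'p, 'b) fctr, ('o, 'a, 'p, 'b) nat_arrow) gcat" where
  "functor_gcat G X C =
    \<lparr>ob = {F. is_functor X C F \<and> on_ob F \<in> extensional (ob X) \<and> on_arr F \<in> extensional (arr X)},
     arr = {(F, F', \<eta>). is_nat_trans X C F F' \<eta> \<and> \<eta> \<in> extensional (ob X) \<and>
              on_ob F \<in> extensional (ob X) \<and> on_arr F \<in> extensional (arr X) \<and>
              on_ob F' \<in> extensional (ob X) \<and> on_arr F' \<in> extensional (arr X)},
     src = (\<lambda>(F, F', \<eta>). F),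
     tgt = (\<lambda>(F, F', \<eta>). F'),
     ident = (\<lambda>F. (F, F, \<lambda>x \<in> ob X. ident C (on_ob F x))),
     comp = (\<lambda>(F', F'', \<theta>) (F, _, \<eta>). (F, F'', \<lambda>x \<in> ob X. comp C (\<theta> x) (\<eta> x))),
     act_ob = conj_ob G X C,
     act_arr = conj_arr G X C\<rparr>"

definition homotopy_fixed ::
  "('g, 'm) monoid_scheme \<Rightarrow> 'g set \<Rightarrow> ('g, 'o, 'a, 'z) gcat_scheme \<Rightarrow>
   (('g, 'g \<times> 'g, 'o, 'a) fctr, ('g, 'g \<times> 'g, 'o, 'a) nat_arrow) cat" where
  "homotopy_fixed G H C = fixed_cat H (functor_gcat G (tilde G) C)"

definition postcomp ::
  "('o, 'a, 'z) cat_scheme \<Rightarrow> ('p, 'b, 'q, 'c) fctr \<Rightarrow>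
   (('o, 'a, 'p, 'b) fctr, ('o, 'a, 'p, 'b) nat_arrow,
    ('o, 'a, 'q, 'c) fctr, ('o, 'a, 'q, 'c) nat_arrow) fctr" where
  "postcomp X \<Theta> =
    \<lparr>on_ob = (\<lambda>F. restrict_fctr X (comp_fctr \<Theta> F)),
     on_arr = (\<lambda>(F, F', \<eta>).
       (restrict_fctr X (comp_fctr \<Theta> F), restrict_fctr X (comp_fctr \<Theta> F'),
        \<lambda>x \<in> ob X. on_arr \<Theta> (\<eta> x)))\<rparr>"

end

theory Submission
  imports Defs
begin

text \<open>
  A functor is an equivalence iff it is fully faithful and essentially surjective, so it suffices to
  prove these two properties for the functor induced on homotopy fixed points. Full faithfulness is
  inherited componentwise: the unique lifts of the components of an \<open>H\<close>-fixed transformation are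
  natural and \<open>H\<close>-fixed by faithfulness of \<open>\<Theta>\<close>. For essential surjectivity, \<open>H\<close> acts freely on
  \<open>G\<close>, so given an \<open>H\<close>-fixed functor \<open>E\<close> one may choose objects \<open>c\<close> and isomorphisms
  \<open>\<Theta> c \<cong> E r\<close> at representatives \<open>r\<close> of the cosets \<open>H x\<close> only, and extend them equivariantly
  to all of \<open>G\<close>; since \<open>\<Theta>\<close> is fully faithful, \<open>E\<close> then lifts along these isomorphisms to an
  \<open>H\<close>-fixed functor.
\<close>

section \<open>Fully faithful and essentially surjective functors\<close>

context category
begin

lemma hom_setD:
  assumes "f \<in> hom_set C x y"
  shows "f \<in> arr C" "src C f = x" "tgt C f = y" "x \<in> ob C" "y \<in> ob C"
  using assms src_in tgt_in by (auto simp: hom_set_def)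

lemma ident_hom: "x \<in> ob C \<Longrightarrow> ident C x \<in> hom_set C x x"
  by (simp add: hom_set_def ident_in src_ident tgt_ident)

lemma comp_hom: "\<lbrakk>f \<in> hom_set C x y; g \<in> hom_set C y z\<rbrakk> \<Longrightarrow> comp C g f \<in> hom_set C x z"
  by (auto simp: hom_set_def comp_in src_comp tgt_comp)

lemma comp_ident_left_hom: "f \<in> hom_set C x y \<Longrightarrow> comp C (ident C y) f = f"
  using comp_ident_left by (auto simp: hom_set_def)

lemma comp_ident_right_hom: "f \<in> hom_set C x y \<Longrightarrow> comp C f (ident C x) = f"
  using comp_ident_right by (auto simp: hom_set_def)

lemma comp_assoc_hom:
  "\<lbrakk>f \<in> hom_set C w x; g \<in> hom_set C x y; h \<in> hom_set C y z\<rbrakk>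
    \<Longrightarrow> comp C h (comp C g f) = comp C (comp C h g) f"
  using comp_assoc by (auto simp: hom_set_def)

lemma is_isoI:
  "\<lbrakk>f \<in> hom_set C x y; g \<in> hom_set C y x; comp C g f = ident C x; comp C f g = ident C y\<rbrakk>
    \<Longrightarrow> is_iso C f"
  by (auto simp: hom_set_def is_iso_def)

lemma is_isoE:
  assumes "is_iso C f" "f \<in> hom_set C x y"
  obtains g where "g \<in> hom_set C y x" "comp C g f = ident C x" "comp C f g = ident C y"
  using assms by (auto simp: hom_set_def is_iso_def)

lemma iso_cancel_left:
  assumes i: "is_iso C i" "i \<in> hom_set C y z"
    and f: "f \<in> hom_set C x y" and g: "g \<in> hom_set C x y"
    and eq: "comp C i f = comp C i g"
  shows "f = g"
proof -
  obtain j where j: "j \<in> hom_set C z y" "comp C j i = ident C y"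
    using is_isoE[OF i] by metis
  have "f = comp C j (comp C i f)"
    using comp_assoc_hom[OF f i(2) j(1)] j comp_ident_left_hom[OF f] by simp
  also have "\<dots> = g"
    using comp_assoc_hom[OF g i(2) j(1)] j comp_ident_left_hom[OF g] eq by simp
  finally show ?thesis .
qed

lemma iso_cancel_right:
  assumes i: "is_iso C i" "i \<in> hom_set C x y"
    and f: "f \<in> hom_set C y z" and g: "g \<in> hom_set C y z"
    and eq: "comp C f i = comp C g i"
  shows "f = g"
proof -
  obtain j where j: "j \<in> hom_set C y x" "comp C i j = ident C y"
    using is_isoE[OF i] by metis
  have "f = comp C (comp C f i) j"
    using comp_assoc_hom[OF j(1) i(2) f] j comp_ident_right_hom[OF f] by simp
  also have "\<dots> = g"
    using comp_assoc_hom[OF j(1) i(2) g] j comp_ident_right_hom[OF g] eq by simp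
  finally show ?thesis .
qed

end

section \<open>Functors and natural isomorphisms in terms of hom-sets\<close>

lemma is_functorD:
  assumes "is_functor C D F"
  shows "category C" "category D"
    and "x \<in> ob C \<Longrightarrow> on_ob F x \<in> ob D"
    and "f \<in> hom_set C x y \<Longrightarrow> on_arr F f \<in> hom_set D (on_ob F x) (on_ob F y)"
    and "x \<in> ob C \<Longrightarrow> on_arr F (ident C x) = ident D (on_ob F x)"
    and "\<lbrakk>f \<in> hom_set C x y; g \<in> hom_set C y z\<rbrakk>
      \<Longrightarrow> on_arr F (comp C g f) = comp D (on_arr F g) (on_arr F f)"
  using assms by (auto simp: is_functor_def hom_set_def)

lemma is_functorI:
  assumes "category C" "category D"
    and "\<And>x. x \<in> ob C \<Longrightarrow> on_ob F x \<in> ob D"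
    and "\<And>f x y. f \<in> hom_set C x y \<Longrightarrow> on_arr F f \<in> hom_set D (on_ob F x) (on_ob F y)"
    and "\<And>x. x \<in> ob C \<Longrightarrow> on_arr F (ident C x) = ident D (on_ob F x)"
    and "\<And>f g x y z. \<lbrakk>f \<in> hom_set C x y; g \<in> hom_set C y z\<rbrakk>
      \<Longrightarrow> on_arr F (comp C g f) = comp D (on_arr F g) (on_arr F f)"
  shows "is_functor C D F"
  using assms unfolding is_functor_def hom_set_def by simp

lemma is_functor_id_fctr: "category C \<Longrightarrow> is_functor C C id_fctr"
  by (rule is_functorI) (simp_all add: id_fctr_def)

lemma is_functor_comp_fctr:
  assumes F: "is_functor C D F" and K: "is_functor D E K"
  shows "is_functor C E (comp_fctr K F)"
proof (rule is_functorI)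
  show "category C" "category E" using is_functorD(1,2)[OF F] is_functorD(1,2)[OF K] by auto
qed (use is_functorD(3-6)[OF F] is_functorD(3-6)[OF K] in \<open>simp_all add: comp_fctr_def, metis\<close>)

text \<open>The functor laws only test values on objects and arrows of \<open>X\<close>, so
  normalising elsewhere does not disturb them. This produces the extensional representatives that
  the functor category demands.\<close>

lemma is_functor_restrict_fctr:
  assumes F: "is_functor X C F"
  shows "is_functor X C (restrict_fctr X F)"
proof (rule is_functorI)
  interpret X: category X using is_functorD(1)[OF F] .
  show "category X" "category C" using is_functorD(1,2)[OF F] .
  show "on_arr (restrict_fctr X F) f
      \<in> hom_set C (on_ob (restrict_fctr X F) x) (on_ob (restrict_fctr X F) y)"
    if "f \<in> hom_set X x y" for f x y
    using that X.hom_setD[OF that] is_functorD(4)[OF F that] by (simp add: restrict_fctr_def)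
  show "on_arr (restrict_fctr X F) (comp X g f)
      = comp C (on_arr (restrict_fctr X F) g) (on_arr (restrict_fctr X F) f)"
    if "f \<in> hom_set X x y" "g \<in> hom_set X y z" for f g x y z
    using X.hom_setD[OF that(1)] X.hom_setD[OF that(2)] X.hom_setD[OF X.comp_hom[OF that]]
      is_functorD(6)[OF F that] by (simp add: restrict_fctr_def)
qed (use is_functorD[OF F] in \<open>auto simp: restrict_fctr_def category.ident_in\<close>)

lemma is_nat_isoD:
  assumes "is_nat_iso C D F F' \<eta>"
  shows "x \<in> ob C \<Longrightarrow> \<eta> x \<in> hom_set D (on_ob F x) (on_ob F' x)"
    and "x \<in> ob C \<Longrightarrow> is_iso D (\<eta> x)"
    and "f \<in> hom_set C x y \<Longrightarrow> comp D (on_arr F' f) (\<eta> x) = comp D (\<eta> y) (on_arr F f)"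
  using assms by (auto simp: is_nat_iso_def is_nat_trans_def hom_set_def)

section \<open>Equivalences characterised by hom-set bijections and essential surjectivity\<close>

definition fully_faithful ::
  "('o, 'a, 'y) cat_scheme \<Rightarrow> ('p, 'b, 'z) cat_scheme \<Rightarrow> ('o, 'a, 'p, 'b) fctr \<Rightarrow> bool" where
  "fully_faithful C D F \<longleftrightarrow> (\<forall>x \<in> ob C. \<forall>y \<in> ob C.
     bij_betw (on_arr F) (hom_set C x y) (hom_set D (on_ob F x) (on_ob F y)))"

definition essentially_surjective ::
  "('o, 'a, 'y) cat_scheme \<Rightarrow> ('p, 'b, 'z) cat_scheme \<Rightarrow> ('o, 'a, 'p, 'b) fctr \<Rightarrow> bool" where
  "essentially_surjective C D F \<longleftrightarrow> (\<forall>d \<in> ob D. \<exists>c \<in> ob C. \<exists>f \<in> hom_set D (on_ob F c) d. is_iso D f)"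

lemma fully_faithful_eqI:
  assumes "fully_faithful C D F" "x \<in> ob C" "y \<in> ob C"
    and "f \<in> hom_set C x y" "g \<in> hom_set C x y" "on_arr F f = on_arr F g"
  shows "f = g"
  using assms unfolding fully_faithful_def bij_betw_def inj_on_def by blast

lemma fully_faithful_lift:
  assumes "fully_faithful C D F" "x \<in> ob C" "y \<in> ob C" "u \<in> hom_set D (on_ob F x) (on_ob F y)"
  obtains f where "f \<in> hom_set C x y" "on_arr F f = u"
  using assms unfolding fully_faithful_def bij_betw_def by (metis imageE)

text \<open>Naturality of the unit gives \<open>\<eta> y\<close> \<circ> \<open>f\<close> =
  \<open>K (F f)\<close> \<circ> \<open>\<eta> x\<close>, so \<open>F f\<close> determines the left
  side, and the isomorphism \<open>\<eta> y\<close> can be cancelled.\<close>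

lemma faithful_if_unit_iso:
  assumes F: "is_functor C D F" and K: "is_functor D C K"
    and eta: "is_nat_iso C C id_fctr (comp_fctr K F) \<eta>"
    and f: "f \<in> hom_set C x y" and g: "g \<in> hom_set C x y"
    and eq: "on_arr F f = on_arr F g"
  shows "f = g"
proof -
  interpret C: category C using is_functorD(1)[OF F] .
  note xy = C.hom_setD(4,5)[OF f]
  show ?thesis
  proof (rule C.iso_cancel_left[OF _ _ f g])
    show "is_iso C (\<eta> y)" using is_nat_isoD(2)[OF eta] xy by simp
    show "\<eta> y \<in> hom_set C y (on_ob K (on_ob F y))"
      using is_nat_isoD(1)[OF eta xy(2)] by (simp add: id_fctr_def comp_fctr_def)
    show "comp C (\<eta> y) f = comp C (\<eta> y) g"
      using is_nat_isoD(3)[OF eta f] is_nat_isoD(3)[OF eta g] eq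
      by (simp add: id_fctr_def comp_fctr_def)
  qed
qed

text \<open>The mirror argument with the counit: \<open>f\<close> \<circ>
  \<open>\<epsilon> x\<close> is determined by \<open>K f\<close>. Faithfulness of the quasi-inverse
  \<open>K\<close> is what yields fullness of \<open>F\<close> below.\<close>

lemma faithful_if_counit_iso:
  assumes F: "is_functor C D F" and K: "is_functor D C K"
    and eps: "is_nat_iso D D (comp_fctr F K) id_fctr \<epsilon>"
    and f: "f \<in> hom_set D x y" and g: "g \<in> hom_set D x y"
    and eq: "on_arr K f = on_arr K g"
  shows "f = g"
proof -
  interpret D: category D using is_functorD(2)[OF F] .
  note xy = D.hom_setD(4,5)[OF f]
  show ?thesis
  proof (rule D.iso_cancel_right[OF _ _ f g])
    show "is_iso D (\<epsilon> x)" using is_nat_isoD(2)[OF eps] xy by simp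
    show "\<epsilon> x \<in> hom_set D (on_ob F (on_ob K x)) x"
      using is_nat_isoD(1)[OF eps xy(1)] by (simp add: id_fctr_def comp_fctr_def)
    show "comp D f (\<epsilon> x) = comp D g (\<epsilon> x)"
      using is_nat_isoD(3)[OF eps f] is_nat_isoD(3)[OF eps g] eq
      by (simp add: id_fctr_def comp_fctr_def)
  qed
qed

text \<open>For fullness, \<open>u\<close> is carried by \<open>K\<close> into \<open>C\<close> and
  conjugated by the unit to an arrow \<open>f\<close>. Naturality of the unit forces
  \<open>K (F f) = K u\<close>, and faithfulness of \<open>K\<close> then gives
  \<open>F f = u\<close>.\<close>

lemma equivalence_fully_faithful:
  assumes "is_equivalence C D F"
  shows "fully_faithful C D F"
proof -
  obtain K \<eta> \<epsilon> where F: "is_functor C D F" and K: "is_functor D C K"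
    and eta: "is_nat_iso C C id_fctr (comp_fctr K F) \<eta>"
    and eps: "is_nat_iso D D (comp_fctr F K) id_fctr \<epsilon>"
    using assms unfolding is_equivalence_def by blast
  interpret C: category C using is_functorD(1)[OF F] .
  have full: "\<exists>f \<in> hom_set C x y. on_arr F f = u"
    if x: "x \<in> ob C" and y: "y \<in> ob C" and u: "u \<in> hom_set D (on_ob F x) (on_ob F y)" for x y u
  proof -
    have ex: "\<eta> x \<in> hom_set C x (on_ob K (on_ob F x))"
      and ey: "\<eta> y \<in> hom_set C y (on_ob K (on_ob F y))"
      using is_nat_isoD(1)[OF eta x] is_nat_isoD(1)[OF eta y]
      by (simp_all add: id_fctr_def comp_fctr_def)
    obtain j where j: "j \<in> hom_set C (on_ob K (on_ob F y)) y"
      "comp C (\<eta> y) j = ident C (on_ob K (on_ob F y))"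
      using C.is_isoE[OF is_nat_isoD(2)[OF eta y] ey] by metis
    note Ku = is_functorD(4)[OF K u]
    note Kue = C.comp_hom[OF ex Ku]
    \<comment> \<open>With \<open>j\<close> the inverse of \<open>\<eta> y\<close>, this is the only
      arrow whose naturality square with the unit can have \<open>K u\<close> as its other
      side.\<close>
    define f where "f = comp C j (comp C (on_arr K u) (\<eta> x))"
    have f: "f \<in> hom_set C x y"
      unfolding f_def using C.comp_hom[OF Kue j(1)] .
    note Ff = is_functorD(4)[OF F f]
    have "comp C (on_arr K (on_arr F f)) (\<eta> x) = comp C (\<eta> y) f"
      using is_nat_isoD(3)[OF eta f] by (simp add: id_fctr_def comp_fctr_def)
    also have "\<dots> = comp C (on_arr K u) (\<eta> x)"
      using C.comp_assoc_hom[OF Kue j(1) ey] j(2) C.comp_ident_left_hom[OF Kue]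
      by (simp add: f_def)
    finally have "on_arr K (on_arr F f) = on_arr K u"
      using C.iso_cancel_right[OF is_nat_isoD(2)[OF eta x] ex is_functorD(4)[OF K Ff] Ku] by blast
    then show ?thesis
      using faithful_if_counit_iso[OF F K eps Ff u] f by blast
  qed
  show ?thesis
    unfolding fully_faithful_def
  proof (intro ballI bij_betw_imageI)
    fix x y assume "x \<in> ob C" "y \<in> ob C"
    then show "on_arr F ` hom_set C x y = hom_set D (on_ob F x) (on_ob F y)"
      using full is_functorD(4)[OF F] by blast
    show "inj_on (on_arr F) (hom_set C x y)"
      using faithful_if_unit_iso[OF F K eta] by (blast intro: inj_onI)
  qed
qed

text \<open>The preimage of \<open>d\<close> up to isomorphism is \<open>K d\<close>, compared with
  \<open>d\<close> by the counit component.\<close>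

lemma equivalence_essentially_surjective:
  assumes "is_equivalence C D F"
  shows "essentially_surjective C D F"
proof -
  obtain K \<epsilon> where K: "is_functor D C K" and eps: "is_nat_iso D D (comp_fctr F K) id_fctr \<epsilon>"
    using assms unfolding is_equivalence_def by blast
  show ?thesis
    unfolding essentially_surjective_def
    using is_functorD(3)[OF K] is_nat_isoD(1,2)[OF eps]
    by (simp add: id_fctr_def comp_fctr_def) blast
qed

text \<open>The object map \<open>c\<close> is prescribed, and \<open>f\<close> must go to the
  unique arrow whose image under \<open>F\<close> is the conjugate of \<open>E f\<close> by the
  isomorphisms \<beta>. The lemma serves twice: with \<open>E\<close> the identity it builds a
  quasi-inverse, and with \<open>X\<close> the category \<open>tilde G\<close> it lifts a homotopy
  fixed object.\<close>

lemma lift_functor_along_isos: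
  assumes F: "is_functor C D F" and ff: "fully_faithful C D F" and E: "is_functor X D E"
    and c: "\<And>x. x \<in> ob X \<Longrightarrow> c x \<in> ob C"
    and b: "\<And>x. x \<in> ob X \<Longrightarrow> \<beta> x \<in> hom_set D (on_ob F (c x)) (on_ob E x)"
    and iso: "\<And>x. x \<in> ob X \<Longrightarrow> is_iso D (\<beta> x)"
  obtains K where "is_functor X C K" "on_ob K = c"
    "\<And>f x y. f \<in> hom_set X x y \<Longrightarrow>
      comp D (on_arr E f) (\<beta> x) = comp D (\<beta> y) (on_arr F (on_arr K f))"
proof -
  interpret C: category C using is_functorD(1)[OF F] .
  interpret D: category D using is_functorD(2)[OF F] .
  interpret X: category X using is_functorD(1)[OF E] .
  have ex: "\<exists>k. k \<in> hom_set C (c x) (c y) \<and>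
      comp D (on_arr E f) (\<beta> x) = comp D (\<beta> y) (on_arr F k)"
    if f: "f \<in> hom_set X x y" for f x y
  proof -
    note xy = X.hom_setD(4,5)[OF f]
    note Ef = is_functorD(4)[OF E f]
    note bx = b[OF xy(1)] and by' = b[OF xy(2)]
    note Efb = D.comp_hom[OF bx Ef]
    obtain j where j: "j \<in> hom_set D (on_ob E y) (on_ob F (c y))"
        "comp D (\<beta> y) j = ident D (on_ob E y)"
      using D.is_isoE[OF iso[OF xy(2)] by'] by metis
    obtain k where k: "k \<in> hom_set C (c x) (c y)"
        "on_arr F k = comp D j (comp D (on_arr E f) (\<beta> x))"
      using fully_faithful_lift[OF ff c[OF xy(1)] c[OF xy(2)] D.comp_hom[OF Efb j(1)]] .
    then show ?thesis
      using D.comp_assoc_hom[OF Efb j(1) by'] j(2) D.comp_ident_left_hom[OF Efb] by auto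
  qed
  have "\<forall>f \<in> arr X. \<exists>k. k \<in> hom_set C (c (src X f)) (c (tgt X f)) \<and>
      comp D (on_arr E f) (\<beta> (src X f)) = comp D (\<beta> (tgt X f)) (on_arr F k)"
    using ex by (simp add: hom_set_def)
  then obtain k where k: "\<forall>f \<in> arr X. k f \<in> hom_set C (c (src X f)) (c (tgt X f)) \<and>
      comp D (on_arr E f) (\<beta> (src X f)) = comp D (\<beta> (tgt X f)) (on_arr F (k f))"
    by metis
  have k1: "k f \<in> hom_set C (c x) (c y)"
    and k2: "comp D (on_arr E f) (\<beta> x) = comp D (\<beta> y) (on_arr F (k f))"
    if "f \<in> hom_set X x y" for f x y
    using k that by (auto simp: hom_set_def)
  \<comment> \<open>Cancelling \<open>\<beta> y\<close> and using faithfulness of \<open>F\<close>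
    shows that the square determines \<open>k f\<close>. Each functor law then only requires that
    the identity, or the composite, closes the right square.\<close>
  have unique: "k f = l"
    if f: "f \<in> hom_set X x y" and l: "l \<in> hom_set C (c x) (c y)"
      and eq: "comp D (on_arr E f) (\<beta> x) = comp D (\<beta> y) (on_arr F l)" for f x y l
  proof -
    note xy = X.hom_setD(4,5)[OF f]
    have "on_arr F (k f) = on_arr F l"
      using D.iso_cancel_left[OF iso[OF xy(2)] b[OF xy(2)] is_functorD(4)[OF F k1[OF f]]
          is_functorD(4)[OF F l]] k2[OF f] eq by simp
    then show ?thesis
      using fully_faithful_eqI[OF ff c[OF xy(1)] c[OF xy(2)] k1[OF f] l] by simp
  qed
  show thesis
  proof (rule that[of "\<lparr>on_ob = c, on_arr = k\<rparr>"])
    show "is_functor X C \<lparr>on_ob = c, on_arr = k\<rparr>"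
    proof (rule is_functorI, goal_cases)
      case (5 x)
      have "comp D (on_arr E (ident X x)) (\<beta> x) = comp D (\<beta> x) (on_arr F (ident C (c x)))"
        using 5 is_functorD(5)[OF E] is_functorD(5)[OF F] c b[OF 5]
          D.comp_ident_left_hom D.comp_ident_right_hom by simp
      then show ?case
        using unique[OF X.ident_hom[OF 5] C.ident_hom[OF c[OF 5]]] by simp
    next
      case (6 f g x y z)
      note xy = X.hom_setD(4,5)[OF 6(1)] X.hom_setD(5)[OF 6(2)]
      note Ef = is_functorD(4)[OF E 6(1)] and Eg = is_functorD(4)[OF E 6(2)]
      note kf = k1[OF 6(1)] and kg = k1[OF 6(2)]
      note Fkf = is_functorD(4)[OF F kf] and Fkg = is_functorD(4)[OF F kg]
      \<comment> \<open>The squares of \<open>f\<close> and \<open>g\<close> are pasted along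
        \<open>\<beta> y\<close>.\<close>
      have "comp D (on_arr E (comp X g f)) (\<beta> x) = comp D (on_arr E g) (comp D (on_arr E f) (\<beta> x))"
        using D.comp_assoc_hom[OF b[OF xy(1)] Ef Eg] is_functorD(6)[OF E 6] by simp
      also have "\<dots> = comp D (comp D (on_arr E g) (\<beta> y)) (on_arr F (k f))"
        using k2[OF 6(1)] D.comp_assoc_hom[OF Fkf b[OF xy(2)] Eg] by simp
      also have "\<dots> = comp D (\<beta> z) (on_arr F (comp C (k g) (k f)))"
        using k2[OF 6(2)] D.comp_assoc_hom[OF Fkf Fkg b[OF xy(3)]] is_functorD(6)[OF F kf kg]
        by simp
      finally show ?case
        using unique[OF X.comp_hom[OF 6] C.comp_hom[OF kf kg]] by simp
    qed (use c k1 C.category_axioms X.category_axioms in auto)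
  qed (use k2 in auto)
qed

text \<open>The inverse in \<open>D\<close> lifts by fullness, and faithfulness lifts the two
  inverse laws.\<close>

lemma fully_faithful_iso_reflect:
  assumes F: "is_functor C D F" and ff: "fully_faithful C D F"
    and f: "f \<in> hom_set C x y" and iso: "is_iso D (on_arr F f)"
  shows "is_iso C f"
proof -
  interpret C: category C using is_functorD(1)[OF F] .
  interpret D: category D using is_functorD(2)[OF F] .
  note xy = C.hom_setD(4,5)[OF f]
  obtain u where u: "u \<in> hom_set D (on_ob F y) (on_ob F x)"
      "comp D u (on_arr F f) = ident D (on_ob F x)"
      "comp D (on_arr F f) u = ident D (on_ob F y)"
    using D.is_isoE[OF iso is_functorD(4)[OF F f]] .
  obtain g where g: "g \<in> hom_set C y x" "on_arr F g = u"
    using fully_faithful_lift[OF ff xy(2,1) u(1)] .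
  show ?thesis
  proof (rule C.is_isoI[OF f g(1)])
    show "comp C g f = ident C x"
      using fully_faithful_eqI[OF ff xy(1,1) C.comp_hom[OF f g(1)] C.ident_hom[OF xy(1)]]
        is_functorD(5)[OF F xy(1)] is_functorD(6)[OF F f g(1)] u g by simp
    show "comp C f g = ident C y"
      using fully_faithful_eqI[OF ff xy(2,2) C.comp_hom[OF g(1) f] C.ident_hom[OF xy(2)]]
        is_functorD(5)[OF F xy(2)] is_functorD(6)[OF F g(1) f] u g by simp
  qed
qed

lemma fully_faithful_essentially_surjective_equivalence:
  assumes F: "is_functor C D F" and ff: "fully_faithful C D F"
    and es: "essentially_surjective C D F"
  shows "is_equivalence C D F"
proof -
  interpret C: category C using is_functorD(1)[OF F] .
  interpret D: category D using is_functorD(2)[OF F] .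
  \<comment> \<open>One preimage \<open>c d\<close> and one isomorphism \<open>e d\<close> from
    \<open>F (c d)\<close> to \<open>d\<close> are chosen for every object \<open>d\<close>;
    \<open>e\<close> will be the counit.\<close>
  obtain c e where c: "\<And>d. d \<in> ob D \<Longrightarrow> c d \<in> ob C"
    and e: "\<And>d. d \<in> ob D \<Longrightarrow> e d \<in> hom_set D (on_ob F (c d)) d"
    and iso: "\<And>d. d \<in> ob D \<Longrightarrow> is_iso D (e d)"
    using es unfolding essentially_surjective_def by metis
  \<comment> \<open>The identity functor of \<open>D\<close> is lifted along \<open>e\<close>. The
    resulting squares \<open>K2\<close> are exactly naturality of the counit.\<close>
  obtain K where K: "is_functor D C K" and Kc: "on_ob K = c"
    and K2: "\<And>f x y. f \<in> hom_set D x y \<Longrightarrow>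
      comp D (on_arr id_fctr f) (e x) = comp D (e y) (on_arr F (on_arr K f))"
    using lift_functor_along_isos[OF F ff is_functor_id_fctr[OF D.category_axioms], of c e] c e iso
    by (auto simp: id_fctr_def)
  have eps: "is_nat_iso D D (comp_fctr F K) id_fctr e"
    unfolding is_nat_iso_def is_nat_trans_def
    using is_functor_comp_fctr[OF K F] is_functor_id_fctr[OF D.category_axioms] e iso K2
    by (auto simp: comp_fctr_def id_fctr_def Kc hom_set_def)
  \<comment> \<open>The unit at \<open>x\<close> is the lift of the inverse of
    \<open>e (F x)\<close>; the middle equation is a triangle identity.\<close>
  have "\<exists>n. n \<in> hom_set C x (c (on_ob F x)) \<and>
      comp D (e (on_ob F x)) (on_arr F n) = ident D (on_ob F x) \<and> is_iso C n"
    if x: "x \<in> ob C" for x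
  proof -
    note Fx = is_functorD(3)[OF F x]
    obtain j where j: "j \<in> hom_set D (on_ob F x) (on_ob F (c (on_ob F x)))"
      "comp D j (e (on_ob F x)) = ident D (on_ob F (c (on_ob F x)))"
      "comp D (e (on_ob F x)) j = ident D (on_ob F x)"
      using D.is_isoE[OF iso[OF Fx] e[OF Fx]] by metis
    obtain n where n: "n \<in> hom_set C x (c (on_ob F x))" "on_arr F n = j"
      using fully_faithful_lift[OF ff x c[OF Fx] j(1)] .
    have "is_iso C n"
      using fully_faithful_iso_reflect[OF F ff n(1)] D.is_isoI[OF j(1) e[OF Fx] j(3,2)] n by simp
    then show ?thesis using n j by auto
  qed
  then obtain n where n: "\<And>x. x \<in> ob C \<Longrightarrow> n x \<in> hom_set C x (c (on_ob F x))"
    and n2: "\<And>x. x \<in> ob C \<Longrightarrow> comp D (e (on_ob F x)) (on_arr F (n x)) = ident D (on_ob F x)"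
    and n3: "\<And>x. x \<in> ob C \<Longrightarrow> is_iso C (n x)"
    by metis
  \<comment> \<open>After applying \<open>F\<close> and composing with \<open>e (F y)\<close>, both
    sides collapse to \<open>F f\<close> by the triangle identity. Cancelling \<open>e (F y)\<close>
    and faithfulness of \<open>F\<close> remove these two operations.\<close>
  have nat: "comp C (on_arr K (on_arr F f)) (n x) = comp C (n y) f"
    if f: "f \<in> hom_set C x y" for f x y
  proof -
    note xy = C.hom_setD(4,5)[OF f]
    note Fxy = is_functorD(3)[OF F xy(1)] is_functorD(3)[OF F xy(2)]
    note Ff = is_functorD(4)[OF F f]
    note KFf = is_functorD(4)[OF K Ff, unfolded Kc]
    note FKFf = is_functorD(4)[OF F KFf]
    note Fnx = is_functorD(4)[OF F n[OF xy(1)]] and Fny = is_functorD(4)[OF F n[OF xy(2)]]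
    have "comp D (e (on_ob F y)) (on_arr F (comp C (on_arr K (on_arr F f)) (n x)))
        = comp D (comp D (e (on_ob F y)) (on_arr F (on_arr K (on_arr F f)))) (on_arr F (n x))"
      using is_functorD(6)[OF F n[OF xy(1)] KFf] D.comp_assoc_hom[OF Fnx FKFf e[OF Fxy(2)]] by simp
    also have "\<dots> = comp D (comp D (on_arr F f) (e (on_ob F x))) (on_arr F (n x))"
      using K2[OF Ff] by (simp add: id_fctr_def)
    also have "\<dots> = on_arr F f"
      using D.comp_assoc_hom[OF Fnx e[OF Fxy(1)] Ff] n2[OF xy(1)] D.comp_ident_right_hom[OF Ff]
      by simp
    also have "\<dots> = comp D (e (on_ob F y)) (on_arr F (comp C (n y) f))"
      using is_functorD(6)[OF F f n[OF xy(2)]] D.comp_assoc_hom[OF Ff Fny e[OF Fxy(2)]]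
        n2[OF xy(2)] D.comp_ident_left_hom[OF Ff] by simp
    finally have eq: "on_arr F (comp C (on_arr K (on_arr F f)) (n x)) = on_arr F (comp C (n y) f)"
      using D.iso_cancel_left[OF iso[OF Fxy(2)] e[OF Fxy(2)]]
        is_functorD(4)[OF F C.comp_hom[OF n[OF xy(1)] KFf]]
        is_functorD(4)[OF F C.comp_hom[OF f n[OF xy(2)]]] by blast
    show ?thesis
      using fully_faithful_eqI[OF ff xy(1) c[OF Fxy(2)] C.comp_hom[OF n[OF xy(1)] KFf]
          C.comp_hom[OF f n[OF xy(2)]] eq] .
  qed
  have eta: "is_nat_iso C C id_fctr (comp_fctr K F) n"
    unfolding is_nat_iso_def is_nat_trans_def
    using is_functor_comp_fctr[OF F K] is_functor_id_fctr[OF C.category_axioms] n n3 nat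
    by (auto simp: comp_fctr_def id_fctr_def Kc hom_set_def)
  show ?thesis
    unfolding is_equivalence_def using F K eta eps by blast
qed

section \<open>Homotopy fixed point categories\<close>

lemma tilde_simps [simp]:
  "ob (tilde G) = carrier G" "arr (tilde G) = carrier G \<times> carrier G"
  "src (tilde G) = fst" "tgt (tilde G) = snd" "ident (tilde G) x = (x, x)"
  "comp (tilde G) k f = (fst f, snd k)"
  "act_ob (tilde G) g x = g \<otimes>\<^bsub>G\<^esub> x"
  "act_arr (tilde G) g f = (g \<otimes>\<^bsub>G\<^esub> fst f, g \<otimes>\<^bsub>G\<^esub> snd f)"
  by (simp_all add: tilde_def)

lemma hom_set_tilde:
  "f \<in> hom_set (tilde G) x y \<longleftrightarrow> f = (x, y) \<and> x \<in> carrier G \<and> y \<in> carrier G"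
  by (cases f) (auto simp: hom_set_def)

lemma category_tilde: "category (tilde G)"
  by unfold_locales auto

lemma is_gcatD:
  assumes "is_gcat G C"
  shows "category C"
    and "\<lbrakk>g \<in> carrier G; x \<in> ob C\<rbrakk> \<Longrightarrow> act_ob C g x \<in> ob C"
    and "\<lbrakk>g \<in> carrier G; f \<in> hom_set C x y\<rbrakk>
      \<Longrightarrow> act_arr C g f \<in> hom_set C (act_ob C g x) (act_ob C g y)"
    and "\<lbrakk>g \<in> carrier G; x \<in> ob C\<rbrakk> \<Longrightarrow> act_arr C g (ident C x) = ident C (act_ob C g x)"
    and "\<lbrakk>g \<in> carrier G; f \<in> hom_set C x y; k \<in> hom_set C y z\<rbrakk>
      \<Longrightarrow> act_arr C g (comp C k f) = comp C (act_arr C g k) (act_arr C g f)"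
    and "\<lbrakk>g \<in> carrier G; h \<in> carrier G; x \<in> ob C\<rbrakk>
      \<Longrightarrow> act_ob C g (act_ob C h x) = act_ob C (g \<otimes>\<^bsub>G\<^esub> h) x"
    and "\<lbrakk>g \<in> carrier G; h \<in> carrier G; f \<in> arr C\<rbrakk>
      \<Longrightarrow> act_arr C g (act_arr C h f) = act_arr C (g \<otimes>\<^bsub>G\<^esub> h) f"
  using assms by (auto simp: is_gcat_def is_functor_def hom_set_def)

lemma is_gcat_act_iso:
  assumes C: "is_gcat G C" and g: "g \<in> carrier G" and f: "f \<in> hom_set C x y" and iso: "is_iso C f"
  shows "is_iso C (act_arr C g f)"
proof -
  interpret C: category C using is_gcatD(1)[OF C] .
  obtain k where k: "k \<in> hom_set C y x" "comp C k f = ident C x" "comp C f k = ident C y"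
    using C.is_isoE[OF iso f] .
  show ?thesis
    using C.is_isoI[OF is_gcatD(3)[OF C g f] is_gcatD(3)[OF C g k(1)]]
      is_gcatD(4)[OF C g] is_gcatD(5)[OF C g f k(1)] is_gcatD(5)[OF C g k(1) f]
      C.hom_setD(4,5)[OF f] k by simp
qed

text \<open>Since functors and transformations are stored as extensional maps, this turns being
  fixed, an equation of total functions, into pointwise equations over the group.\<close>

lemma restrict_eq_iff: "p \<in> extensional A \<Longrightarrow> restrict q A = p \<longleftrightarrow> (\<forall>x \<in> A. q x = p x)"
  by (auto simp: fun_eq_iff extensional_def)

section \<open>Fixed points of conjugation as equivariant data\<close>

context group
begin

text \<open>Substituting \<open>h x\<close> for \<open>x\<close> turns invariance under conjugation into equivariance.\<close>

lemma conj_invariant_iff: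
  assumes "h \<in> carrier G"
  shows "(\<forall>x \<in> carrier G. a (p (inv h \<otimes> x)) = p x) \<longleftrightarrow> (\<forall>x \<in> carrier G. p (h \<otimes> x) = a (p x))"
proof safe
  fix x assume "\<forall>x \<in> carrier G. a (p (inv h \<otimes> x)) = p x" "x \<in> carrier G"
  then show "p (h \<otimes> x) = a (p x)"
    using assms by (metis inv_solve_left' m_closed)
next
  fix x assume "\<forall>x \<in> carrier G. p (h \<otimes> x) = a (p x)" "x \<in> carrier G"
  then show "a (p (inv h \<otimes> x)) = p x"
    using assms by (metis inv_closed inv_solve_left m_closed)
qed

text \<open>The same substitution at both ends of an arrow of \<open>tilde G\<close>, on which the
  group acts diagonally.\<close>

lemma conj_invariant_iff2:
  assumes "h \<in> carrier G"
  shows "(\<forall>x \<in> carrier G. \<forall>y \<in> carrier G. a (p (inv h \<otimes> x, inv h \<otimes> y)) = p (x, y)) \<longleftrightarrow>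
    (\<forall>x \<in> carrier G. \<forall>y \<in> carrier G. p (h \<otimes> x, h \<otimes> y) = a (p (x, y)))"
proof safe
  fix x y
  assume "\<forall>x \<in> carrier G. \<forall>y \<in> carrier G. a (p (inv h \<otimes> x, inv h \<otimes> y)) = p (x, y)"
    "x \<in> carrier G" "y \<in> carrier G"
  then show "p (h \<otimes> x, h \<otimes> y) = a (p (x, y))"
    using assms by (metis inv_solve_left' m_closed)
next
  fix x y
  assume "\<forall>x \<in> carrier G. \<forall>y \<in> carrier G. p (h \<otimes> x, h \<otimes> y) = a (p (x, y))"
    "x \<in> carrier G" "y \<in> carrier G"
  then show "a (p (inv h \<otimes> x, inv h \<otimes> y)) = p (x, y)"
    using assms by (metis inv_closed inv_solve_left m_closed)
qed

lemma conj_ob_eq_iff: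
  assumes "h \<in> carrier G" "on_ob F \<in> extensional (carrier G)"
    "on_arr F \<in> extensional (carrier G \<times> carrier G)"
  shows "conj_ob G (tilde G) C h F = F \<longleftrightarrow>
    (\<forall>x \<in> carrier G. on_ob F (h \<otimes> x) = act_ob C h (on_ob F x)) \<and>
    (\<forall>x \<in> carrier G. \<forall>y \<in> carrier G. on_arr F (h \<otimes> x, h \<otimes> y) = act_arr C h (on_arr F (x, y)))"
proof -
  have "conj_ob G (tilde G) C h F = F \<longleftrightarrow>
      (\<forall>x \<in> carrier G. act_ob C h (on_ob F (inv h \<otimes> x)) = on_ob F x) \<and>
      (\<forall>x \<in> carrier G. \<forall>y \<in> carrier G.
         act_arr C h (on_arr F (inv h \<otimes> x, inv h \<otimes> y)) = on_arr F (x, y))"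
    using assms(2,3) by (cases F) (simp add: conj_ob_def restrict_fctr_def restrict_eq_iff)
  then show ?thesis
    using conj_invariant_iff[OF assms(1), of "act_ob C h" "on_ob F"]
      conj_invariant_iff2[OF assms(1), of "act_arr C h" "on_arr F"] by simp
qed

text \<open>Homotopy fixed objects are the \<open>H\<close>-equivariant functors from
  \<open>tilde G\<close> to \<open>C\<close>. This form is free of inverses, and later membership
  proofs go through it.\<close>

lemma in_ob_homotopy_fixed:
  assumes "subgroup H G"
  shows "F \<in> ob (homotopy_fixed G H C) \<longleftrightarrow>
    is_functor (tilde G) C F \<and> on_ob F \<in> extensional (carrier G) \<and>
    on_arr F \<in> extensional (carrier G \<times> carrier G) \<and>
    (\<forall>h \<in> H. \<forall>x \<in> carrier G. on_ob F (h \<otimes> x) = act_ob C h (on_ob F x)) \<and>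
    (\<forall>h \<in> H. \<forall>x \<in> carrier G. \<forall>y \<in> carrier G.
       on_arr F (h \<otimes> x, h \<otimes> y) = act_arr C h (on_arr F (x, y)))"
  using subgroup.mem_carrier[OF assms]
  by (auto simp: homotopy_fixed_def fixed_cat_def functor_gcat_def conj_ob_eq_iff)

text \<open>An arrow is a triple that carries its source and target, and conjugation acts on all
  three entries. Fixedness of the triple therefore already makes \<open>F\<close> and
  \<open>F'\<close> fixed objects.\<close>

lemma in_arr_homotopy_fixed:
  assumes "subgroup H G"
  shows "(F, F', \<eta>) \<in> arr (homotopy_fixed G H C) \<longleftrightarrow>
    F \<in> ob (homotopy_fixed G H C) \<and> F' \<in> ob (homotopy_fixed G H C) \<and>
    \<eta> \<in> extensional (carrier G) \<and>
    (\<forall>x \<in> carrier G. \<eta> x \<in> hom_set C (on_ob F x) (on_ob F' x)) \<and>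
    (\<forall>x \<in> carrier G. \<forall>y \<in> carrier G.
       comp C (on_arr F' (x, y)) (\<eta> x) = comp C (\<eta> y) (on_arr F (x, y))) \<and>
    (\<forall>h \<in> H. \<forall>x \<in> carrier G. \<eta> (h \<otimes> x) = act_arr C h (\<eta> x))"
proof -
  have "restrict (\<lambda>x. act_arr C h (\<eta> (inv h \<otimes> x))) (carrier G) = \<eta> \<longleftrightarrow>
      (\<forall>x \<in> carrier G. \<eta> (h \<otimes> x) = act_arr C h (\<eta> x))"
    if "\<eta> \<in> extensional (carrier G)" "h \<in> H" for h
    using conj_invariant_iff[of h "act_arr C h" \<eta>] subgroup.mem_carrier[OF assms that(2)]
      restrict_eq_iff[OF that(1)] by simp
  then show ?thesis
    by (auto simp: homotopy_fixed_def fixed_cat_def functor_gcat_def conj_arr_def is_nat_trans_def)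
qed

end

lemma homotopy_fixed_simps [simp]:
  "src (homotopy_fixed G H C) (F, F', \<eta>) = F"
  "tgt (homotopy_fixed G H C) (F, F', \<eta>) = F'"
  "ident (homotopy_fixed G H C) F = (F, F, \<lambda>x \<in> carrier G. ident C (on_ob F x))"
  "comp (homotopy_fixed G H C) (F1, F2, \<theta>) (F3, F4, \<eta>)
    = (F3, F2, \<lambda>x \<in> carrier G. comp C (\<theta> x) (\<eta> x))"
  by (simp_all add: homotopy_fixed_def fixed_cat_def functor_gcat_def)

section \<open>Structure of the homotopy fixed point category\<close>

context
  fixes G :: "('g, 'm) monoid_scheme" (structure) and H :: "'g set"
  assumes G: "group G" and H: "subgroup H G"
begin

interpretation group G using G .

lemmas H_carrier = subgroup.mem_carrier[OF H]

lemma homotopy_fixed_obD: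
  assumes "F \<in> ob (homotopy_fixed G H C)"
  shows "is_functor (tilde G) C F"
    and "on_ob F \<in> extensional (carrier G)" "on_arr F \<in> extensional (carrier G \<times> carrier G)"
    and "x \<in> carrier G \<Longrightarrow> on_ob F x \<in> ob C"
    and "\<lbrakk>x \<in> carrier G; y \<in> carrier G\<rbrakk> \<Longrightarrow> on_arr F (x, y) \<in> hom_set C (on_ob F x) (on_ob F y)"
    and "\<lbrakk>h \<in> H; x \<in> carrier G\<rbrakk> \<Longrightarrow> on_ob F (h \<otimes> x) = act_ob C h (on_ob F x)"
    and "\<lbrakk>h \<in> H; x \<in> carrier G; y \<in> carrier G\<rbrakk>
      \<Longrightarrow> on_arr F (h \<otimes> x, h \<otimes> y) = act_arr C h (on_arr F (x, y))"
proof -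
  show F: "is_functor (tilde G) C F"
    using assms by (simp add: in_ob_homotopy_fixed[OF H])
  show "x \<in> carrier G \<Longrightarrow> on_ob F x \<in> ob C"
    using is_functorD(3)[OF F] by simp
  show "\<lbrakk>x \<in> carrier G; y \<in> carrier G\<rbrakk>
      \<Longrightarrow> on_arr F (x, y) \<in> hom_set C (on_ob F x) (on_ob F y)"
    using is_functorD(4)[OF F] by (simp add: hom_set_tilde)
qed (use assms in \<open>simp_all add: in_ob_homotopy_fixed[OF H]\<close>)

lemma in_hom_homotopy_fixed:
  "f \<in> hom_set (homotopy_fixed G H C) F F' \<longleftrightarrow>
    (\<exists>\<eta>. f = (F, F', \<eta>) \<and> (F, F', \<eta>) \<in> arr (homotopy_fixed G H C))"
  by (cases f) (auto simp: hom_set_def)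

lemma homotopy_fixed_arrD:
  assumes "(F, F', \<eta>) \<in> arr (homotopy_fixed G H C)"
  shows "F \<in> ob (homotopy_fixed G H C)" "F' \<in> ob (homotopy_fixed G H C)"
    and "\<eta> \<in> extensional (carrier G)"
    and "x \<in> carrier G \<Longrightarrow> \<eta> x \<in> hom_set C (on_ob F x) (on_ob F' x)"
    and "\<lbrakk>x \<in> carrier G; y \<in> carrier G\<rbrakk> \<Longrightarrow>
       comp C (on_arr F' (x, y)) (\<eta> x) = comp C (\<eta> y) (on_arr F (x, y))"
    and "\<lbrakk>h \<in> H; x \<in> carrier G\<rbrakk> \<Longrightarrow> \<eta> (h \<otimes> x) = act_arr C h (\<eta> x)"
  using assms by (auto simp: in_arr_homotopy_fixed[OF H])

lemma homotopy_fixed_ident_in: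
  assumes C: "is_gcat G C" and F: "F \<in> ob (homotopy_fixed G H C)"
  shows "(F, F, \<lambda>x \<in> carrier G. ident C (on_ob F x)) \<in> arr (homotopy_fixed G H C)"
proof -
  interpret C: category C using is_gcatD(1)[OF C] .
  note F' = homotopy_fixed_obD[OF F]
  show ?thesis
    unfolding in_arr_homotopy_fixed[OF H]
  proof (intro conjI ballI F)
    fix x y assume xy: "x \<in> carrier G" "y \<in> carrier G"
    show "comp C (on_arr F (x, y)) ((\<lambda>x\<in>carrier G. ident C (on_ob F x)) x)
        = comp C ((\<lambda>x\<in>carrier G. ident C (on_ob F x)) y) (on_arr F (x, y))"
      using xy C.comp_ident_left_hom[OF F'(5)[OF xy]] C.comp_ident_right_hom[OF F'(5)[OF xy]]
      by simp
  qed (use F'(4,6) C.ident_hom is_gcatD(4)[OF C] H_carrier in simp_all)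
qed

lemma homotopy_fixed_comp_in:
  assumes C: "is_gcat G C" and f: "(F, F', \<eta>) \<in> arr (homotopy_fixed G H C)"
    and g: "(F', F'', \<theta>) \<in> arr (homotopy_fixed G H C)"
  shows "(F, F'', \<lambda>x \<in> carrier G. comp C (\<theta> x) (\<eta> x)) \<in> arr (homotopy_fixed G H C)"
proof -
  interpret C: category C using is_gcatD(1)[OF C] .
  note f' = homotopy_fixed_arrD[OF f] and g' = homotopy_fixed_arrD[OF g]
  note F = homotopy_fixed_obD[OF f'(1)] and F' = homotopy_fixed_obD[OF f'(2)]
    and F'' = homotopy_fixed_obD[OF g'(2)]
  show ?thesis
    unfolding in_arr_homotopy_fixed[OF H]
  proof (intro conjI ballI)
    fix x assume x: "x \<in> carrier G"
    show "(\<lambda>x\<in>carrier G. comp C (\<theta> x) (\<eta> x)) x \<in> hom_set C (on_ob F x) (on_ob F'' x)"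
      using x C.comp_hom[OF f'(4)[OF x] g'(4)[OF x]] by simp
    show "(\<lambda>x\<in>carrier G. comp C (\<theta> x) (\<eta> x)) (h \<otimes> x)
        = act_arr C h ((\<lambda>x\<in>carrier G. comp C (\<theta> x) (\<eta> x)) x)" if h: "h \<in> H" for h
      using x h H_carrier[OF h] f'(6)[OF h x] g'(6)[OF h x]
        is_gcatD(5)[OF C H_carrier[OF h] f'(4)[OF x] g'(4)[OF x]] by simp
    fix y assume y: "y \<in> carrier G"
    \<comment> \<open>The naturality squares of \<theta> and \<eta> are pasted, moving first
      \<theta> and then \<eta> past the functors.\<close>
    have "comp C (on_arr F'' (x, y)) (comp C (\<theta> x) (\<eta> x))
        = comp C (comp C (\<theta> y) (on_arr F' (x, y))) (\<eta> x)"
      using C.comp_assoc_hom[OF f'(4)[OF x] g'(4)[OF x] F''(5)[OF x y]] g'(5)[OF x y] by simp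
    also have "\<dots> = comp C (comp C (\<theta> y) (\<eta> y)) (on_arr F (x, y))"
      using C.comp_assoc_hom[OF f'(4)[OF x] F'(5)[OF x y] g'(4)[OF y]] f'(5)[OF x y]
        C.comp_assoc_hom[OF F(5)[OF x y] f'(4)[OF y] g'(4)[OF y]] by simp
    finally show "comp C (on_arr F'' (x, y)) ((\<lambda>x\<in>carrier G. comp C (\<theta> x) (\<eta> x)) x)
        = comp C ((\<lambda>x\<in>carrier G. comp C (\<theta> x) (\<eta> x)) y) (on_arr F (x, y))"
      using x y by simp
  qed (use f'(1) g'(2) in simp_all)
qed

text \<open>The laws hold componentwise. The unit laws also use that the family of components is
  extensional, since composition restricts its result to \<open>carrier G\<close>.\<close>

lemma category_homotopy_fixed:
  assumes C: "is_gcat G C"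
  shows "category (homotopy_fixed G H C)"
proof -
  interpret C: category C using is_gcatD(1)[OF C] .
  show ?thesis
  proof (unfold_locales, goal_cases)
    case (1 f)
    then show ?case using homotopy_fixed_arrD(1) by (cases f) auto
  next
    case (2 f)
    then show ?case using homotopy_fixed_arrD(2) by (cases f) auto
  next
    case (3 F)
    then show ?case using homotopy_fixed_ident_in[OF C] by simp
  next
    case (6 f g)
    then show ?case using homotopy_fixed_comp_in[OF C] by (cases f; cases g) auto
  next
    case (7 f g)
    then show ?case by (cases f; cases g) auto
  next
    case (8 f g)
    then show ?case by (cases f; cases g) auto
  next
    case (9 f)
    obtain F F' \<eta> where f: "f = (F, F', \<eta>)" by (cases f)
    note f' = homotopy_fixed_arrD[OF 9[unfolded f]]
    show ?case
      using f'(3) C.comp_ident_right_hom[OF f'(4)] unfolding f by (simp add: restrict_eq_iff)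
  next
    case (10 f)
    obtain F F' \<eta> where f: "f = (F, F', \<eta>)" by (cases f)
    note f' = homotopy_fixed_arrD[OF 10[unfolded f]]
    show ?case
      using f'(3) C.comp_ident_left_hom[OF f'(4)] unfolding f by (simp add: restrict_eq_iff)
  next
    case (11 f g k)
    obtain F F' \<eta> F'' \<theta> F''' \<zeta> where
      fgk: "f = (F, F', \<eta>)" "g = (F', F'', \<theta>)" "k = (F'', F''', \<zeta>)"
      using 11(4,5) by (cases f; cases g; cases k) auto
    note f = homotopy_fixed_arrD[OF 11(1)[unfolded fgk]]
      and g = homotopy_fixed_arrD[OF 11(2)[unfolded fgk]]
      and k = homotopy_fixed_arrD[OF 11(3)[unfolded fgk]]
    show ?case
      using C.comp_assoc_hom[OF f(4) g(4) k(4)] unfolding fgk by (auto intro!: restrict_ext)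
  qed auto
qed

text \<open>The pointwise inverses are chosen independently, but an inverse is unique, so they
  automatically form a natural and equivariant family.\<close>

lemma homotopy_fixed_isoI:
  assumes C: "is_gcat G C" and f: "(F, F', \<eta>) \<in> arr (homotopy_fixed G H C)"
    and iso: "\<And>x. x \<in> carrier G \<Longrightarrow> is_iso C (\<eta> x)"
  shows "is_iso (homotopy_fixed G H C) (F, F', \<eta>)"
proof -
  interpret C: category C using is_gcatD(1)[OF C] .
  interpret A: category "homotopy_fixed G H C" using category_homotopy_fixed[OF C] .
  note f' = homotopy_fixed_arrD[OF f]
  note F = homotopy_fixed_obD[OF f'(1)] and F' = homotopy_fixed_obD[OF f'(2)]
  have "\<exists>k. k \<in> hom_set C (on_ob F' x) (on_ob F x) \<and>
      comp C k (\<eta> x) = ident C (on_ob F x) \<and> comp C (\<eta> x) k = ident C (on_ob F' x)"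
    if x: "x \<in> carrier G" for x
    using C.is_isoE[OF iso[OF x] f'(4)[OF x]] by metis
  then obtain k where k: "\<And>x. x \<in> carrier G \<Longrightarrow> k x \<in> hom_set C (on_ob F' x) (on_ob F x)"
    and k1: "\<And>x. x \<in> carrier G \<Longrightarrow> comp C (k x) (\<eta> x) = ident C (on_ob F x)"
    and k2: "\<And>x. x \<in> carrier G \<Longrightarrow> comp C (\<eta> x) (k x) = ident C (on_ob F' x)"
    by metis
  \<comment> \<open>Composed with \<open>\<eta> y\<close> on the left, both sides become
    \<open>F' (x, y)\<close>.\<close>
  have nat: "comp C (on_arr F (x, y)) (k x) = comp C (k y) (on_arr F' (x, y))"
    if x: "x \<in> carrier G" and y: "y \<in> carrier G" for x y
  proof (rule C.iso_cancel_left[OF iso[OF y] f'(4)[OF y]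
        C.comp_hom[OF k[OF x] F(5)[OF x y]] C.comp_hom[OF F'(5)[OF x y] k[OF y]]])
    have "comp C (\<eta> y) (comp C (on_arr F (x, y)) (k x))
        = comp C (on_arr F' (x, y)) (comp C (\<eta> x) (k x))"
      using C.comp_assoc_hom[OF k[OF x] F(5)[OF x y] f'(4)[OF y]] f'(5)[OF x y]
        C.comp_assoc_hom[OF k[OF x] f'(4)[OF x] F'(5)[OF x y]] by simp
    also have "\<dots> = comp C (\<eta> y) (comp C (k y) (on_arr F' (x, y)))"
      using C.comp_assoc_hom[OF F'(5)[OF x y] k[OF y] f'(4)[OF y]] k2[OF x] k2[OF y]
        C.comp_ident_left_hom[OF F'(5)[OF x y]] C.comp_ident_right_hom[OF F'(5)[OF x y]] by simp
    finally show "comp C (\<eta> y) (comp C (on_arr F (x, y)) (k x))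
        = comp C (\<eta> y) (comp C (k y) (on_arr F' (x, y)))" .
  qed
  \<comment> \<open>Both arrows are right inverses of the isomorphism
    \<open>\<eta> (h \<otimes> x)\<close>, the second because the action of \<open>h\<close>
    preserves composites and identities.\<close>
  have equiv: "k (h \<otimes> x) = act_arr C h (k x)" if h: "h \<in> H" and x: "x \<in> carrier G" for h x
  proof -
    note hG = H_carrier[OF h]
    have hx: "h \<otimes> x \<in> carrier G" using hG x by simp
    have ak: "act_arr C h (k x) \<in> hom_set C (on_ob F' (h \<otimes> x)) (on_ob F (h \<otimes> x))"
      using is_gcatD(3)[OF C hG k[OF x]] F(6)[OF h x] F'(6)[OF h x] by simp
    have "comp C (\<eta> (h \<otimes> x)) (act_arr C h (k x)) = act_arr C h (ident C (on_ob F' x))"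
      using is_gcatD(5)[OF C hG k[OF x] f'(4)[OF x]] k2[OF x] f'(6)[OF h x] by simp
    also have "\<dots> = comp C (\<eta> (h \<otimes> x)) (k (h \<otimes> x))"
      using is_gcatD(4)[OF C hG F'(4)[OF x]] k2[OF hx] F'(6)[OF h x] by simp
    finally show ?thesis
      using C.iso_cancel_left[OF iso[OF hx] f'(4)[OF hx] ak k[OF hx]] by simp
  qed
  have inv: "(F', F, restrict k (carrier G)) \<in> arr (homotopy_fixed G H C)"
    unfolding in_arr_homotopy_fixed[OF H] using f'(1,2) k nat equiv H_carrier by simp
  show ?thesis
    by (rule A.is_isoI[of _ F F' "(F', F, restrict k (carrier G))"])
      (use f inv k1 k2 in \<open>auto simp: in_hom_homotopy_fixed intro!: restrict_ext\<close>)
qed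

section \<open>Postcomposition with an equivariant functor\<close>

lemma is_equivariant_functorD:
  assumes "is_equivariant_functor G C D \<Theta>"
  shows "is_functor C D \<Theta>"
    and "\<lbrakk>g \<in> carrier G; x \<in> ob C\<rbrakk> \<Longrightarrow> on_ob \<Theta> (act_ob C g x) = act_ob D g (on_ob \<Theta> x)"
    and "\<lbrakk>g \<in> carrier G; f \<in> hom_set C x y\<rbrakk>
      \<Longrightarrow> on_arr \<Theta> (act_arr C g f) = act_arr D g (on_arr \<Theta> f)"
  using assms by (auto simp: is_equivariant_functor_def hom_set_def)

lemma postcomp_simps [simp]:
  "x \<in> carrier G \<Longrightarrow> on_ob (on_ob (postcomp (tilde G) \<Theta>) F) x = on_ob \<Theta> (on_ob F x)"
  "\<lbrakk>x \<in> carrier G; y \<in> carrier G\<rbrakk>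
    \<Longrightarrow> on_arr (on_ob (postcomp (tilde G) \<Theta>) F) (x, y) = on_arr \<Theta> (on_arr F (x, y))"
  "on_arr (postcomp (tilde G) \<Theta>) (F, F', \<eta>) =
    (on_ob (postcomp (tilde G) \<Theta>) F, on_ob (postcomp (tilde G) \<Theta>) F',
      \<lambda>x \<in> carrier G. on_arr \<Theta> (\<eta> x))"
  by (simp_all add: postcomp_def restrict_fctr_def comp_fctr_def)

text \<open>Strict commutation of \<Theta> with the action makes the composite of two equivariant
  functors equivariant, on objects and on arrows.\<close>

lemma postcomp_ob_in:
  assumes T: "is_equivariant_functor G C D \<Theta>" and F: "F \<in> ob (homotopy_fixed G H C)"
  shows "on_ob (postcomp (tilde G) \<Theta>) F \<in> ob (homotopy_fixed G H D)"
proof -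
  note F' = homotopy_fixed_obD[OF F] and T' = is_equivariant_functorD[OF T]
  have "is_functor (tilde G) D (on_ob (postcomp (tilde G) \<Theta>) F)"
    using is_functor_restrict_fctr[OF is_functor_comp_fctr[OF F'(1) T'(1)]]
    by (simp add: postcomp_def)
  moreover have "on_ob (on_ob (postcomp (tilde G) \<Theta>) F) \<in> extensional (carrier G)"
    "on_arr (on_ob (postcomp (tilde G) \<Theta>) F) \<in> extensional (carrier G \<times> carrier G)"
    by (simp_all add: postcomp_def restrict_fctr_def)
  ultimately show ?thesis
    unfolding in_ob_homotopy_fixed[OF H]
    using F'(4,6,7) T'(2) T'(3)[OF _ F'(5)] H_carrier by simp
qed

lemma postcomp_arr_in:
  assumes T: "is_equivariant_functor G C D \<Theta>"
    and f: "(F, F', \<eta>) \<in> arr (homotopy_fixed G H C)"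
  shows "on_arr (postcomp (tilde G) \<Theta>) (F, F', \<eta>) \<in> arr (homotopy_fixed G H D)"
proof -
  note f' = homotopy_fixed_arrD[OF f] and T' = is_equivariant_functorD[OF T]
  note F = homotopy_fixed_obD[OF f'(1)] and F' = homotopy_fixed_obD[OF f'(2)]
  have "comp D (on_arr \<Theta> (on_arr F' (x, y))) (on_arr \<Theta> (\<eta> x))
      = comp D (on_arr \<Theta> (\<eta> y)) (on_arr \<Theta> (on_arr F (x, y)))"
    if "x \<in> carrier G" "y \<in> carrier G" for x y
    using is_functorD(6)[OF T'(1) f'(4)[OF that(1)] F'(5)[OF that]]
      is_functorD(6)[OF T'(1) F(5)[OF that] f'(4)[OF that(2)]] f'(5)[OF that] by simp
  then show ?thesis
    unfolding postcomp_simps in_arr_homotopy_fixed[OF H]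
    using postcomp_ob_in[OF T] f'(1,2,6) is_functorD(4)[OF T'(1) f'(4)] T'(3)[OF _ f'(4)] H_carrier
    by simp
qed

lemma is_functor_postcomp:
  assumes C: "is_gcat G C" and D: "is_gcat G D" and T: "is_equivariant_functor G C D \<Theta>"
  shows "is_functor (homotopy_fixed G H C) (homotopy_fixed G H D) (postcomp (tilde G) \<Theta>)"
proof (rule is_functorI, goal_cases)
  note T' = is_equivariant_functorD[OF T]
  case (5 F)
  then show ?case
    using is_functorD(5)[OF T'(1)] homotopy_fixed_obD(4)[OF 5] by (auto intro!: restrict_ext)
next
  note T' = is_equivariant_functorD[OF T]
  case (6 f g F F' F'')
  then obtain \<eta> \<theta> where fg: "f = (F, F', \<eta>)" "g = (F', F'', \<theta>)"
    and f: "(F, F', \<eta>) \<in> arr (homotopy_fixed G H C)"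
    and g: "(F', F'', \<theta>) \<in> arr (homotopy_fixed G H C)"
    by (auto simp: in_hom_homotopy_fixed)
  show ?case
    using is_functorD(6)[OF T'(1) homotopy_fixed_arrD(4)[OF f] homotopy_fixed_arrD(4)[OF g]]
    unfolding fg by (auto intro!: restrict_ext)
next
  case (4 f F F')
  then show ?case
    using postcomp_arr_in[OF T] by (auto simp: in_hom_homotopy_fixed)
qed (use category_homotopy_fixed C D postcomp_ob_in[OF T] in simp_all)

section \<open>Full faithfulness on homotopy fixed points\<close>

lemma fully_faithful_postcomp:
  assumes C: "is_gcat G C" and D: "is_gcat G D" and T: "is_equivariant_functor G C D \<Theta>"
    and ff: "fully_faithful C D \<Theta>"
  shows "fully_faithful (homotopy_fixed G H C) (homotopy_fixed G H D) (postcomp (tilde G) \<Theta>)"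
proof -
  interpret C: category C using is_gcatD(1)[OF C] .
  let ?P = "postcomp (tilde G) \<Theta>"
  let ?A = "homotopy_fixed G H C" and ?B = "homotopy_fixed G H D"
  note T' = is_equivariant_functorD[OF T]
  note P = is_functor_postcomp[OF C D T]
  have faithful: "\<eta> = \<theta>"
    if f: "(F, F', \<eta>) \<in> arr ?A" and g: "(F, F', \<theta>) \<in> arr ?A"
      and eq: "on_arr ?P (F, F', \<eta>) = on_arr ?P (F, F', \<theta>)" for F F' \<eta> \<theta>
  proof (rule extensionalityI[OF homotopy_fixed_arrD(3)[OF f] homotopy_fixed_arrD(3)[OF g]])
    fix x assume x: "x \<in> carrier G"
    \<comment> \<open>The third entries of the two image triples are restricted families; they are
      compared at \<open>x\<close>, which lies in the group.\<close>
    have "on_arr \<Theta> (\<eta> x) = on_arr \<Theta> (\<theta> x)"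
      using fun_cong[of _ _ x] eq x by (auto simp: fun_eq_iff split: if_splits)
    then show "\<eta> x = \<theta> x"
      using fully_faithful_eqI[OF ff] homotopy_fixed_arrD(4)[OF f x]
        homotopy_fixed_arrD(4)[OF g x] C.hom_setD(4,5)[OF homotopy_fixed_arrD(4)[OF f x]] by blast
  qed
  have full: "\<exists>\<eta>. (F, F', \<eta>) \<in> arr ?A \<and> on_arr ?P (F, F', \<eta>) = (on_ob ?P F, on_ob ?P F', \<theta>)"
    if F: "F \<in> ob ?A" and F': "F' \<in> ob ?A"
      and t: "(on_ob ?P F, on_ob ?P F', \<theta>) \<in> arr ?B" for F F' \<theta>
  proof -
    note FD = homotopy_fixed_obD[OF F] and F'D = homotopy_fixed_obD[OF F']
    note tD = homotopy_fixed_arrD[OF t]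
    have t4: "\<theta> x \<in> hom_set D (on_ob \<Theta> (on_ob F x)) (on_ob \<Theta> (on_ob F' x))"
      if "x \<in> carrier G" for x
      using tD(4)[OF that] that by simp
    have "\<exists>n. n \<in> hom_set C (on_ob F x) (on_ob F' x) \<and> on_arr \<Theta> n = \<theta> x"
      if x: "x \<in> carrier G" for x
      using fully_faithful_lift[OF ff FD(4)[OF x] F'D(4)[OF x] t4[OF x]] by metis
    then obtain n where n: "\<And>x. x \<in> carrier G \<Longrightarrow> n x \<in> hom_set C (on_ob F x) (on_ob F' x)"
      and n2: "\<And>x. x \<in> carrier G \<Longrightarrow> on_arr \<Theta> (n x) = \<theta> x"
      by metis
    \<comment> \<open>Under \<Theta> this becomes the naturality square of \<theta>, and \<Theta> is
      faithful.\<close>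
    have nat: "comp C (on_arr F' (x, y)) (n x) = comp C (n y) (on_arr F (x, y))"
      if x: "x \<in> carrier G" and y: "y \<in> carrier G" for x y
      by (rule fully_faithful_eqI[OF ff FD(4)[OF x] F'D(4)[OF y]
            C.comp_hom[OF n[OF x] F'D(5)[OF x y]] C.comp_hom[OF FD(5)[OF x y] n[OF y]]])
        (use tD(5)[OF x y] x y n2 is_functorD(6)[OF T'(1) n[OF x] F'D(5)[OF x y]]
          is_functorD(6)[OF T'(1) FD(5)[OF x y] n[OF y]] in simp)
    \<comment> \<open>Both arrows lift \<open>\<theta> (h \<otimes> x)\<close>: the left one by
      choice, the right one since \<theta> and \<Theta> are equivariant.\<close>
    have equiv: "n (h \<otimes> x) = act_arr C h (n x)" if h: "h \<in> H" and x: "x \<in> carrier G" for h x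
    proof -
      note hG = H_carrier[OF h]
      have hx: "h \<otimes> x \<in> carrier G" using hG x by simp
      have an: "act_arr C h (n x) \<in> hom_set C (on_ob F (h \<otimes> x)) (on_ob F' (h \<otimes> x))"
        using is_gcatD(3)[OF C hG n[OF x]] FD(6)[OF h x] F'D(6)[OF h x] by simp
      show ?thesis
        by (rule fully_faithful_eqI[OF ff FD(4)[OF hx] F'D(4)[OF hx] n[OF hx] an])
          (use T'(3)[OF hG n[OF x]] n2[OF x] n2[OF hx] tD(6)[OF h x] in simp)
    qed
    have "(F, F', restrict n (carrier G)) \<in> arr ?A"
      unfolding in_arr_homotopy_fixed[OF H] using F F' n nat equiv H_carrier by auto
    moreover have "on_arr ?P (F, F', restrict n (carrier G)) = (on_ob ?P F, on_ob ?P F', \<theta>)"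
      using n2 tD(3) by (simp add: restrict_eq_iff)
    ultimately show ?thesis by blast
  qed
  show ?thesis
    unfolding fully_faithful_def
  proof (intro ballI bij_betw_imageI)
    fix F F' assume F: "F \<in> ob ?A" and F': "F' \<in> ob ?A"
    show "inj_on (on_arr ?P) (hom_set ?A F F')"
      by (rule inj_onI) (auto simp: in_hom_homotopy_fixed simp del: postcomp_simps(3) dest: faithful)
    show "on_arr ?P ` hom_set ?A F F' = hom_set ?B (on_ob ?P F) (on_ob ?P F')"
    proof
      show "on_arr ?P ` hom_set ?A F F' \<subseteq> hom_set ?B (on_ob ?P F) (on_ob ?P F')"
        using is_functorD(4)[OF P] by blast
      show "hom_set ?B (on_ob ?P F) (on_ob ?P F') \<subseteq> on_arr ?P ` hom_set ?A F F'"
      proof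
        fix u assume "u \<in> hom_set ?B (on_ob ?P F) (on_ob ?P F')"
        then obtain \<theta> where u: "u = (on_ob ?P F, on_ob ?P F', \<theta>)"
          and t: "(on_ob ?P F, on_ob ?P F', \<theta>) \<in> arr ?B"
          unfolding in_hom_homotopy_fixed by blast
        obtain \<eta> where "(F, F', \<eta>) \<in> arr ?A" "on_arr ?P (F, F', \<eta>) = u"
          using full[OF F F' t] u by blast
        then show "u \<in> on_arr ?P ` hom_set ?A F F'"
          by (intro image_eqI[of _ _ "(F, F', \<eta>)"]) (auto simp: in_hom_homotopy_fixed)
      qed
    qed
  qed
qed

section \<open>Essential surjectivity on homotopy fixed points\<close>

text \<open>The representative \<open>r x\<close> of the coset \<open>H x\<close> yields a splitting \<open>x = s x \<cdot> r x\<close>.\<close>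

lemma equivariant_coset_splitting:
  obtains s r where "\<And>x. x \<in> carrier G \<Longrightarrow> s x \<in> H" "\<And>x. x \<in> carrier G \<Longrightarrow> r x \<in> carrier G"
    "\<And>x. x \<in> carrier G \<Longrightarrow> s x \<otimes> r x = x"
    "\<And>h x. \<lbrakk>h \<in> H; x \<in> carrier G\<rbrakk> \<Longrightarrow> r (h \<otimes> x) = r x"
    "\<And>h x. \<lbrakk>h \<in> H; x \<in> carrier G\<rbrakk> \<Longrightarrow> s (h \<otimes> x) = h \<otimes> s x"
proof -
  define orbit where "orbit x = {k \<otimes> x | k. k \<in> H}" for x
  \<comment> \<open>Choosing from the orbit as a set makes \<open>r\<close> depend on the coset
    alone, so invariance under \<open>H\<close> reduces to equality of orbits.\<close>
  define r where "r x = (SOME y. y \<in> orbit x)" for x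
  define s where "s x = x \<otimes> inv (r x)" for x
  have r: "\<exists>k \<in> H. r x = k \<otimes> x" for x
  proof -
    have "\<one> \<otimes> x \<in> orbit x" using subgroup.one_closed[OF H] by (auto simp: orbit_def)
    then have "r x \<in> orbit x" unfolding r_def by (rule someI)
    then show ?thesis by (auto simp: orbit_def)
  qed
  have rG: "r x \<in> carrier G" if "x \<in> carrier G" for x
    using r[of x] that H_carrier by auto
  \<comment> \<open>One inclusion absorbs \<open>h\<close> into the coefficient, the other cancels
    it with \<open>inv h\<close>; both stay inside \<open>H\<close>.\<close>
  have orbit_eq: "orbit (h \<otimes> x) = orbit x" if h: "h \<in> H" and x: "x \<in> carrier G" for h x
  proof -
    have "k \<otimes> (h \<otimes> x) \<in> orbit x" if k: "k \<in> H" for k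
      using m_assoc[OF H_carrier[OF k] H_carrier[OF h] x, symmetric] subgroup.m_closed[OF H k h]
      unfolding orbit_def by blast
    moreover have "k \<otimes> x \<in> orbit (h \<otimes> x)" if k: "k \<in> H" for k
    proof -
      have "k \<otimes> x = (k \<otimes> inv h) \<otimes> (h \<otimes> x)"
        using H_carrier[OF k] H_carrier[OF h] x by (simp add: m_assoc inv_solve_left)
      then show ?thesis
        using subgroup.m_closed[OF H k subgroup.m_inv_closed[OF H h]] unfolding orbit_def by blast
    qed
    ultimately show ?thesis by (auto simp: orbit_def)
  qed
  show thesis
  proof (rule that[of s r])
    fix x assume x: "x \<in> carrier G"
    obtain k where k: "k \<in> H" "r x = k \<otimes> x" using r by blast
    \<comment> \<open>Since \<open>r x\<close> is \<open>k \<otimes> x\<close>, the quotient of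
      \<open>x\<close> by \<open>r x\<close> loses \<open>x\<close> and leaves an element of
      \<open>H\<close>.\<close>
    have "s x = inv k"
      using k H_carrier[OF k(1)] x by (simp add: s_def inv_mult_group inv_solve_left')
        (simp add: m_assoc[symmetric])
    then show "s x \<in> H" using k subgroup.m_inv_closed[OF H] by simp
    show "r x \<in> carrier G" using rG x .
    show "s x \<otimes> r x = x" using x rG[OF x] by (simp add: s_def m_assoc)
  next
    fix h x assume h: "h \<in> H" and x: "x \<in> carrier G"
    show rh: "r (h \<otimes> x) = r x" using orbit_eq[OF h x] by (simp add: r_def)
    show "s (h \<otimes> x) = h \<otimes> s x" using rh x rG[OF x] H_carrier[OF h] by (simp add: s_def m_assoc)
  qed
qed

lemma essentially_surjective_postcomp:
  assumes C: "is_gcat G C" and D: "is_gcat G D" and T: "is_equivariant_functor G C D \<Theta>"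
    and ff: "fully_faithful C D \<Theta>" and es: "essentially_surjective C D \<Theta>"
  shows "essentially_surjective (homotopy_fixed G H C) (homotopy_fixed G H D)
    (postcomp (tilde G) \<Theta>)"
  unfolding essentially_surjective_def
proof
  interpret C: category C using is_gcatD(1)[OF C] .
  interpret D: category D using is_gcatD(1)[OF D] .
  let ?P = "postcomp (tilde G) \<Theta>"
  let ?A = "homotopy_fixed G H C" and ?B = "homotopy_fixed G H D"
  note T' = is_equivariant_functorD[OF T]
  fix E assume E: "E \<in> ob ?B"
  note ED = homotopy_fixed_obD[OF E]
  obtain s r where s: "\<And>x. x \<in> carrier G \<Longrightarrow> s x \<in> H"
    and r: "\<And>x. x \<in> carrier G \<Longrightarrow> r x \<in> carrier G"
    and sr: "\<And>x. x \<in> carrier G \<Longrightarrow> s x \<otimes> r x = x"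
    and rh: "\<And>h x. \<lbrakk>h \<in> H; x \<in> carrier G\<rbrakk> \<Longrightarrow> r (h \<otimes> x) = r x"
    and sh: "\<And>h x. \<lbrakk>h \<in> H; x \<in> carrier G\<rbrakk> \<Longrightarrow> s (h \<otimes> x) = h \<otimes> s x"
    by (rule equivariant_coset_splitting) blast
  note sG = H_carrier[OF s]
  \<comment> \<open>These choices need not be compatible with the action; only their values at
    representatives \<open>r x\<close> enter below.\<close>
  have "\<forall>x \<in> carrier G. \<exists>c b. c \<in> ob C \<and> b \<in> hom_set D (on_ob \<Theta> c) (on_ob E x) \<and> is_iso D b"
    using es ED(4) unfolding essentially_surjective_def by blast
  then obtain c0 b0 where c0: "\<And>x. x \<in> carrier G \<Longrightarrow> c0 x \<in> ob C"
    and b0: "\<And>x. x \<in> carrier G \<Longrightarrow> b0 x \<in> hom_set D (on_ob \<Theta> (c0 x)) (on_ob E x)"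
    and iso0: "\<And>x. x \<in> carrier G \<Longrightarrow> is_iso D (b0 x)"
    by metis
  \<comment> \<open>The data at \<open>r x\<close> are translated to \<open>x\<close> by
    \<open>s x\<close>. As \<open>r\<close> is invariant and \<open>s\<close> is equivariant,
    \<open>c\<close> and \<beta> become equivariant.\<close>
  define c where "c x = act_ob C (s x) (c0 (r x))" for x
  define \<beta> where "\<beta> x = act_arr D (s x) (b0 (r x))" for x
  have c: "c x \<in> ob C" if x: "x \<in> carrier G" for x
    using is_gcatD(2)[OF C sG[OF x] c0[OF r[OF x]]] by (simp add: c_def)
  \<comment> \<open>The target is right because \<open>E\<close> is equivariant: \<open>s x\<close>
    moves \<open>E (r x)\<close> to \<open>E (s x \<otimes> r x)\<close>, which is
    \<open>E x\<close>. The source uses equivariance of \<Theta>.\<close>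
  have b: "\<beta> x \<in> hom_set D (on_ob \<Theta> (c x)) (on_ob E x)" if x: "x \<in> carrier G" for x
    using is_gcatD(3)[OF D sG[OF x] b0[OF r[OF x]]] T'(2)[OF sG[OF x] c0[OF r[OF x]]]
      ED(6)[OF s[OF x] r[OF x]] sr[OF x] by (simp add: \<beta>_def c_def)
  have iso: "is_iso D (\<beta> x)" if x: "x \<in> carrier G" for x
    unfolding \<beta>_def using is_gcat_act_iso[OF D sG[OF x] b0[OF r[OF x]] iso0[OF r[OF x]]] .
  have ch: "c (h \<otimes> x) = act_ob C h (c x)" if h: "h \<in> H" and x: "x \<in> carrier G" for h x
    using is_gcatD(6)[OF C H_carrier[OF h] sG[OF x] c0[OF r[OF x]]] rh[OF h x] sh[OF h x]
    by (simp add: c_def)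
  have bh: "\<beta> (h \<otimes> x) = act_arr D h (\<beta> x)" if h: "h \<in> H" and x: "x \<in> carrier G" for h x
    using is_gcatD(7)[OF D H_carrier[OF h] sG[OF x] D.hom_setD(1)[OF b0[OF r[OF x]]]]
      rh[OF h x] sh[OF h x]
    by (simp add: \<beta>_def)
  obtain K where K: "is_functor (tilde G) C K" and Kc: "on_ob K = c"
    and K2': "\<And>f x y. f \<in> hom_set (tilde G) x y \<Longrightarrow>
      comp D (on_arr E f) (\<beta> x) = comp D (\<beta> y) (on_arr \<Theta> (on_arr K f))"
    using lift_functor_along_isos[OF T'(1) ff ED(1), of c \<beta>] c b iso by auto
  have K1: "on_arr K (x, y) \<in> hom_set C (c x) (c y)"
    and K2: "comp D (on_arr E (x, y)) (\<beta> x) = comp D (\<beta> y) (on_arr \<Theta> (on_arr K (x, y)))"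
    if "x \<in> carrier G" "y \<in> carrier G" for x y
    using is_functorD(4)[OF K, of "(x, y)" x y] K2'[of "(x, y)" x y] that
    by (simp_all add: hom_set_tilde Kc)
  \<comment> \<open>Arrows of \<open>K\<close> come from arbitrary lifts, but the square with
    \<beta> determines them. Translating the square at \<open>(x, y)\<close> by \<open>h\<close>
    gives the square at \<open>(h \<otimes> x, h \<otimes> y)\<close>, so the two candidates
    agree.\<close>
  have Kh: "on_arr K (h \<otimes> x, h \<otimes> y) = act_arr C h (on_arr K (x, y))"
    if h: "h \<in> H" and x: "x \<in> carrier G" and y: "y \<in> carrier G" for h x y
  proof -
    note hG = H_carrier[OF h]
    have hx: "h \<otimes> x \<in> carrier G" and hy: "h \<otimes> y \<in> carrier G" using hG x y by simp_all
    have aK: "act_arr C h (on_arr K (x, y)) \<in> hom_set C (c (h \<otimes> x)) (c (h \<otimes> y))"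
      using is_gcatD(3)[OF C hG K1[OF x y]] ch[OF h x] ch[OF h y] by simp
    note TK = is_functorD(4)[OF T'(1) K1[OF x y]]
    have "comp D (\<beta> (h \<otimes> y)) (on_arr \<Theta> (act_arr C h (on_arr K (x, y))))
        = act_arr D h (comp D (\<beta> y) (on_arr \<Theta> (on_arr K (x, y))))"
      using is_gcatD(5)[OF D hG TK b[OF y]] T'(3)[OF hG K1[OF x y]] bh[OF h y] by simp
    also have "\<dots> = act_arr D h (comp D (on_arr E (x, y)) (\<beta> x))"
      using K2[OF x y] by simp
    also have "\<dots> = comp D (on_arr E (h \<otimes> x, h \<otimes> y)) (\<beta> (h \<otimes> x))"
      using is_gcatD(5)[OF D hG b[OF x] ED(5)[OF x y]] bh[OF h x] ED(7)[OF h x y] by simp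
    also have "\<dots> = comp D (\<beta> (h \<otimes> y)) (on_arr \<Theta> (on_arr K (h \<otimes> x, h \<otimes> y)))"
      using K2[OF hx hy] .
    finally have "on_arr \<Theta> (act_arr C h (on_arr K (x, y))) = on_arr \<Theta> (on_arr K (h \<otimes> x, h \<otimes> y))"
      using D.iso_cancel_left[OF iso[OF hy] b[OF hy] is_functorD(4)[OF T'(1) aK]
          is_functorD(4)[OF T'(1) K1[OF hx hy]]] by simp
    then show ?thesis
      using fully_faithful_eqI[OF ff c[OF hx] c[OF hy] aK K1[OF hx hy]] by simp
  qed
  \<comment> \<open>\<open>K\<close> is unconstrained off the group, so it is normalised to become
    an object of the functor category.\<close>
  define F where "F = restrict_fctr (tilde G) K"
  have F: "F \<in> ob ?A"
    unfolding in_ob_homotopy_fixed[OF H]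
    using is_functor_restrict_fctr[OF K] ch Kh H_carrier
    by (simp add: F_def) (simp add: restrict_fctr_def Kc)
  \<comment> \<open>The comparison isomorphism is \<beta> itself: \<open>K2\<close> gives naturality
    and \<open>bh\<close> gives fixedness.\<close>
  have arr: "(on_ob ?P F, E, restrict \<beta> (carrier G)) \<in> arr ?B"
    unfolding in_arr_homotopy_fixed[OF H]
    using postcomp_ob_in[OF T F] E b bh K2 H_carrier
    by simp (simp add: F_def restrict_fctr_def Kc)
  have "is_iso ?B (on_ob ?P F, E, restrict \<beta> (carrier G))"
    using homotopy_fixed_isoI[OF D arr] iso by simp
  then show "\<exists>F \<in> ob ?A. \<exists>f \<in> hom_set ?B (on_ob ?P F) E. is_iso ?B f"
    using F arr in_hom_homotopy_fixed by blast
qed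

end

theorem proposition1p3:
  fixes G :: "('g, 'm) monoid_scheme"
    and C :: "('g, 'o, 'a, 'y) gcat_scheme"
    and D :: "('g, 'p, 'b, 'z) gcat_scheme"
    and \<Theta> :: "('o, 'a, 'p, 'b) fctr"
  assumes "group G"
    and "is_gcat G C"
    and "is_gcat G D"
    and "is_equivariant_functor G C D \<Theta>"
    and "is_equivalence C D \<Theta>"
  shows "\<forall>H. subgroup H G \<longrightarrow>
    is_equivalence (homotopy_fixed G H C) (homotopy_fixed G H D) (postcomp (tilde G) \<Theta>)"
proof (intro allI impI)
  fix H assume H: "subgroup H G"
  \<comment> \<open>A quasi-inverse of \<Theta> need not be equivariant, so it need not act on
    homotopy fixed points. Only full faithfulness and essential surjectivity of \<Theta> are carried
    over, and a new quasi-inverse is built from them for each \<open>H\<close>.\<close>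
  note ff = equivalence_fully_faithful[OF assms(5)]
  show "is_equivalence (homotopy_fixed G H C) (homotopy_fixed G H D) (postcomp (tilde G) \<Theta>)"
    using fully_faithful_essentially_surjective_equivalence
      is_functor_postcomp[OF assms(1) H assms(2-4)]
      fully_faithful_postcomp[OF assms(1) H assms(2-4) ff]
      essentially_surjective_postcomp[OF assms(1) H assms(2-4) ff
        equivalence_essentially_surjective[OF assms(5)]] .
qed

end
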